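(* (a) A Dyck class $[w]$ belongs to $\mathrm{TAIL}_2(\mu)$ for some partition $\mu$ if and only if $[w]=[v]$ for some cycled ternary Dyck vector $v$. (b) A Dyck class $[w]$ has the form $\mathrm{TI}_2(\mu)$ for some partition $\mu$ if and only if $[w]=[v]$ for some ternary Dyck vector $v$ matching one of these forms: - Type 1: $v=01^m0X2^n$ where $n\ge 1$ and $0\le m\le n$ and $X$ does not end in $2$. - Type 2: $v=0^nY21^m$ where $n\ge 2$ and $0<m<n$ and $Y$ does not begin with $0$. - Type 3: $v=0^n1^n$ or $v=0^n1^{n-1}$ where $n\ge 2$, or $v=0$.
   Context: A quasi-Dyck vector (QDV) is an integer sequence $v=v_1v_2\cdots v_n$ with $v_1=0$ and $v_{i+1}\le v_i+1$ for all $i<n$; a Dyck vector is a QDV with all entries $\ge 0$; a ternary Dyck vector (TDV) is a Dyck vector with entries in $\{0,1,2\}$. A QDV $v$ is a cycled ternary Dyck vector iff $v$ is a TDV or $v=A(B^-)$ for some TDVs $A,B$; equivalently, every $v_i\in\{-1,0,1,2\}$ and there do not exist $j<k$ with $v_j=-1$ and $v_k=2$. We use word notation; $i^c$ means $c$ copies of the symbol $i$; $W^{+}$, $W^-$ add, subtract $1$ from each entry of $W$. Dyck classes $[v]$ are the equivalence classes of the equivalence relation on QDVs generated by $v\sim 0v^+$. An integer partition $\lambda$ (with $\ell(\lambda)$ positive parts and $\lambda_i=0$ for $i>\ell(\lambda)$; the zero partition $\langle 0\rangle=[0]$ is allowed) is identified with the Dyck class consisting of all QDVs $\mathrm{QDV}_n(\lambda)=(0-\lambda_n,1-\lambda_{n-1},\ldots,n-1-\lambda_1)$,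 $n>\ell(\lambda)$; this is a bijection between partitions and Dyck classes. The maps. $\mathrm{NU}_1$ is defined on $D_1=\{\gamma:\gamma_1\le\ell(\gamma)+2\}$ by $\mathrm{NU}_1(\gamma)=\langle\ell+1,\gamma_1-1,\ldots,\gamma_\ell-1\rangle$, $\ell=\ell(\gamma)$ (zero parts dropped); it is a bijection from $D_1$ onto $C_1=\{\gamma\ne\langle 0\rangle:\gamma_1\ge\ell(\gamma)\}$. $\mathrm{NU}_2$ is defined by two rules. Rule (a): $\mathrm{NU}_2([012^hA(-1)^{h-1}])=[00^{h-1}1A1^h]$ for $h\ge 2$ and $A=A_1\cdots A_s$ a list of integers that is empty or satisfies all $A_i\le 2$, $A_s\ge 0$, $A_{i+1}\le A_i+1$ for $i<s$. Rule (b): $\mathrm{NU}_2([012^kB(-1)^k])=[00^kB01^k]$ for $k\ge 1$ and $B=B_1\cdots B_s$ a list of integers that is empty or satisfies all $B_i\le 2$, $B_1\le 1$, $B_s\ge -1$, $B_{i+1}\le B_i+1$ for $i<s$. $\mathrm{NU}_2$ is a bijection from its domain $D_2$ onto its image $C_2$, with $D_1\cap D_2=\emptyset=C_1\cap C_2$; $\mathrm{NU}$ is the combined bijection $D_1\cup D_2\to C_1\cup C_2$ and $\mathrm{ND}$ is its inverse. $\mathrm{NU}$ raises dinv by $1$ (dinv$(v)$ being the number of $i<j\le n$ with $v_i-v_j\in\{0,1\}$, where $v_k=k-1$ for $k\le 0$), so iteration of $\mathrm{ND}$ always stops. Tails. For nonzero $\mu=\langle r^{n_r}\cdots 2^{n_2}1^{n_1}\rangle$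 with $n_r>0$, $B_\mu=01^{n_1}01^{n_2}\cdots 01^{n_r}$; $B_{\langle 0\rangle}$ is empty; $\mathrm{TI}(\mu)=[0B_\mu]$. $\mathrm{TI}_2(\mu)$ is the Dyck class obtained by starting at $\mathrm{TI}(\mu)$ and iterating $\mathrm{ND}$ as many times as possible, and $\mathrm{TAIL}_2(\mu)=\{\mathrm{NU}^m(\mathrm{TI}_2(\mu)):m\ge 0\}$. *)

theory Defs
  imports Main
begin

section \<open>Quasi-Dyck vectors\<close>

definition slow_rise :: "int list \<Rightarrow> bool" where
  "slow_rise v \<longleftrightarrow> (\<forall>i. Suc i < length v \<longrightarrow> v ! Suc i \<le> v ! i + 1)"

definition is_qdv :: "int list \<Rightarrow> bool" where
  "is_qdv v \<longleftrightarrow> v \<noteq> [] \<and> hd v = 0 \<and> slow_rise v"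

definition is_dyck_vector :: "int list \<Rightarrow> bool" where
  "is_dyck_vector v \<longleftrightarrow> is_qdv v \<and> (\<forall>x\<in>set v. x \<ge> 0)"

definition is_tdv :: "int list \<Rightarrow> bool" where
  "is_tdv v \<longleftrightarrow> is_dyck_vector v \<and> set v \<subseteq> {0, 1, 2}"

definition raise :: "int list \<Rightarrow> int list" where
  "raise v = map (\<lambda>x. x + 1) v"

definition lower :: "int list \<Rightarrow> int list" where
  "lower v = map (\<lambda>x. x - 1) v"

definition is_cycled_tdv :: "int list \<Rightarrow> bool" where
  "is_cycled_tdv v \<longleftrightarrow>
     is_qdv v \<and> (is_tdv v \<or> (\<exists>A B. is_tdv A \<and> is_tdv B \<and> v = A @ lower B))"


section \<open>Dyck classes and partitions\<close>

definition dyck_step :: "int list \<Rightarrow> int list \<Rightarrow> bool" where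
  "dyck_step v w \<longleftrightarrow> is_qdv v \<and> is_qdv w \<and> w = 0 # raise v"

text \<open>The class \<open>[v]\<close>; it is meaningful only if \<open>v\<close> is a quasi-Dyck vector.\<close>

definition dyck_class :: "int list \<Rightarrow> int list set" where
  "dyck_class v = {w. equivclp dyck_step v w}"

text \<open>
  A partition is the weakly decreasing list of its positive parts, so that \<open>\<ell>(\<gamma>)\<close> is
  \<open>length \<gamma>\<close> and the zero partition is the empty list.
\<close>

definition is_partition :: "nat list \<Rightarrow> bool" where
  "is_partition \<gamma> \<longleftrightarrow> sorted_wrt (\<ge>) \<gamma> \<and> (\<forall>x\<in>set \<gamma>. x > 0)"

text \<open>Parts are indexed from 1, and \<open>part \<gamma> i = 0\<close> for \<open>i > \<ell>(\<gamma>)\<close>.\<close>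

definition part :: "nat list \<Rightarrow> nat \<Rightarrow> nat" where
  "part \<gamma> i = (if 1 \<le> i \<and> i \<le> length \<gamma> then \<gamma> ! (i - 1) else 0)"

definition qdv_of :: "nat \<Rightarrow> nat list \<Rightarrow> int list" where
  "qdv_of n \<gamma> = map (\<lambda>i. int i - int (part \<gamma> (n - i))) [0..<n]"

text \<open>The Dyck class identified with a partition, and the inverse identification.\<close>

definition class_of :: "nat list \<Rightarrow> int list set" where
  "class_of \<gamma> = {qdv_of n \<gamma> | n. n > length \<gamma>}"

definition partition_of :: "int list set \<Rightarrow> nat list" where
  "partition_of c = (THE \<gamma>. is_partition \<gamma> \<and> class_of \<gamma> = c)"


section \<open>The maps NU and ND\<close>

text \<open>
  The maps act on Dyck classes. They are partial: \<open>D1\<close>, \<open>D2\<close> and \<open>NU_dom\<close> are their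
  domains, and the values of the HOL functions outside these domains carry no meaning.
\<close>

definition D1 :: "int list set set" where
  "D1 = {class_of \<gamma> | \<gamma>. is_partition \<gamma> \<and> part \<gamma> 1 \<le> length \<gamma> + 2}"

definition NU1 :: "int list set \<Rightarrow> int list set" where
  "NU1 c = (let \<gamma> = partition_of c in
     class_of ((length \<gamma> + 1) # filter (\<lambda>x. x > 0) (map (\<lambda>x. x - 1) \<gamma>)))"

inductive NU2_rule :: "int list set \<Rightarrow> int list set \<Rightarrow> bool" where
  rule_a:
  "NU2_rule (dyck_class ([0, 1] @ replicate h 2 @ A @ replicate (h - 1) (-1)))
            (dyck_class ([0] @ replicate (h - 1) 0 @ [1] @ A @ replicate h 1))"
  if "h \<ge> 2" and "A \<noteq> [] \<longrightarrow> (\<forall>x\<in>set A. x \<le> 2) \<and> last A \<ge> 0 \<and> slow_rise A"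
| rule_b:
  "NU2_rule (dyck_class ([0, 1] @ replicate k 2 @ B @ replicate k (-1)))
            (dyck_class ([0] @ replicate k 0 @ B @ [0] @ replicate k 1))"
  if "k \<ge> 1" and "B \<noteq> [] \<longrightarrow> (\<forall>x\<in>set B. x \<le> 2) \<and> hd B \<le> 1 \<and> last B \<ge> -1 \<and> slow_rise B"

definition D2 :: "int list set set" where
  "D2 = {c. \<exists>d. NU2_rule c d}"

definition NU2 :: "int list set \<Rightarrow> int list set" where
  "NU2 c = (THE d. NU2_rule c d)"

definition NU_dom :: "int list set set" where
  "NU_dom = D1 \<union> D2"

definition NU :: "int list set \<Rightarrow> int list set" where
  "NU c = (if c \<in> D1 then NU1 c else NU2 c)"

definition ND_dom :: "int list set set" where
  "ND_dom = NU ` NU_dom"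

definition ND :: "int list set \<Rightarrow> int list set" where
  "ND = the_inv_into NU_dom NU"


section \<open>Tails\<close>

text \<open>
  \<open>B_word \<mu>\<close> concatenates the words \<open>0 1 \<dots> 1\<close> with \<open>n\<^sub>i\<close> ones, \<open>n\<^sub>i\<close> the multiplicity of \<open>i\<close> in
  \<open>\<mu>\<close>, for all \<open>i\<close> from 1 to the largest part, including those with \<open>n\<^sub>i = 0\<close>.
\<close>

definition B_word :: "nat list \<Rightarrow> int list" where
  "B_word \<mu> = concat (map (\<lambda>i. 0 # replicate (count_list \<mu> i) 1) [1..<part \<mu> 1 + 1])"

definition TI :: "nat list \<Rightarrow> int list set" where
  "TI \<mu> = dyck_class (0 # B_word \<mu>)"

text \<open>
  ND is iterated until it is no longer defined. This happens after finitely many steps,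
  since ND lowers the (nonnegative) dinv statistic by 1, so that \<open>LEAST\<close> is well defined.
\<close>

definition TI2 :: "nat list \<Rightarrow> int list set" where
  "TI2 \<mu> = (ND ^^ (LEAST k. (ND ^^ k) (TI \<mu>) \<notin> ND_dom)) (TI \<mu>)"

text \<open>The side condition says that the \<open>m\<close>-fold iterate of NU at \<open>TI2 \<mu>\<close> is defined.\<close>

definition TAIL2 :: "nat list \<Rightarrow> int list set set" where
  "TAIL2 \<mu> = {(NU ^^ m) (TI2 \<mu>) | m. \<forall>i<m. (NU ^^ i) (TI2 \<mu>) \<in> NU_dom}"


section \<open>Special forms of ternary Dyck vectors\<close>

definition type1 :: "int list \<Rightarrow> bool" where
  "type1 v \<longleftrightarrow> (\<exists>m n X. n \<ge> 1 \<and> m \<le> n \<and> \<not> (X \<noteq> [] \<and> last X = 2) \<and>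
     v = [0] @ replicate m 1 @ [0] @ X @ replicate n 2)"

definition type2 :: "int list \<Rightarrow> bool" where
  "type2 v \<longleftrightarrow> (\<exists>m n Y. n \<ge> 2 \<and> 0 < m \<and> m < n \<and> \<not> (Y \<noteq> [] \<and> hd Y = 0) \<and>
     v = replicate n 0 @ Y @ [2] @ replicate m 1)"

definition type3 :: "int list \<Rightarrow> bool" where
  "type3 v \<longleftrightarrow> (\<exists>n\<ge>2. v = replicate n 0 @ replicate n 1 \<or>
     v = replicate n 0 @ replicate (n - 1) 1) \<or> v = [0]"

end

theory Submission
  imports Defs
begin

text \<open>
  A class is a list up to the shift \<open>v \<mapsto> 0 v\<^sup>+\<close>, and on suitable representatives \<open>NU\<close>
  rewrites \<open>01U\<close> to \<open>0U0\<close> or applies rule (a) or (b); comparing last letters and the lengths of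
  initial and final runs shows that this is an injective partial map. Every cycled ternary
  class has a cycled ternary successor, and by a case distinction on the last letter it
  has a cycled ternary predecessor unless it is of Type 1, 2 or 3, when it has no predecessor at all.
  Since \<open>ND\<close> decreases the size of the partition, iterating it from a cycled ternary class ends at
  a class of one of the three types.

  It remains to see that the orbit of a class \<open>T\<close> of Type 1, 2 or 3 contains some \<open>TI(\<mu>)\<close>. The
  deficit (size minus dinv) is invariant under \<open>NU\<close>, and a cycled ternary vector of length \<open>n\<close>
  has deficit at least \<open>n - 3\<close> unless its class is that of a cycled binary vector (letters
  -1, 0, 1 and no -1 before a 1). As the size grows along the orbit, the orbit reaches a cycled
  binary class. From there, undoing rotations leads back to some \<open>TI(\<mu>)\<close>, and as \<open>T\<close> has no
  predecessor this happens within the orbit.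
\<close>

section \<open>Dyck classes as lists up to shifts\<close>

text \<open>The obstacle is that a rule speaks of classes but is read off from words, and no single
  choice of representatives suits all rules. A shift raises the last letter by exactly 1, so fixing
  the last letter fixes the representative; this turns most equalities of classes into equalities of
  lists. Matching a word against rule (a) or (b) is then a comparison of two run lengths, whose
  surplus is absorbed into the free word \<open>A\<close> or \<open>B\<close>. The deficit is the
  right quantity because a step raises size and dinv alike. The number of pairs, n(n-1)/2, occurs in
  both and cancels, leaving a sum over letters and non-dinv pairs whose change is explicit when one
  letter is appended; the bound n - 3 comes from such appending. A class without predecessor gives
  no hint of its partition \<open>\<mu>\<close>. Hence \<open>\<mu>\<close> is never computed from
  it: the forward orbit is only shown to meet a forward orbit of some \<open>TI \<mu>\<close>, and
  injectivity cancels the common steps.\<close>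

definition up :: "int list \<Rightarrow> int list" where
  "up v = 0 # raise v"

lemma raise_simps [simp]:
  "raise [] = []" "raise (x # xs) = (x + 1) # raise xs" "raise (xs @ ys) = raise xs @ raise ys"
  "raise (replicate n x) = replicate n (x + 1)" "length (raise xs) = length xs"
  "raise (lower xs) = xs" "raise xs = [] \<longleftrightarrow> xs = []" "set (raise xs) = (\<lambda>x. x + 1) ` set xs"
  "xs \<noteq> [] \<Longrightarrow> hd (raise xs) = hd xs + 1" "xs \<noteq> [] \<Longrightarrow> last (raise xs) = last xs + 1"
  by (simp_all add: raise_def lower_def hd_map last_map comp_def)

lemma lower_simps [simp]:
  "lower [] = []" "lower (x # xs) = (x - 1) # lower xs" "lower (xs @ ys) = lower xs @ lower ys"
  "lower (replicate n x) = replicate n (x - 1)" "length (lower xs) = length xs"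
  "lower (raise xs) = xs" "lower xs = [] \<longleftrightarrow> xs = []" "set (lower xs) = (\<lambda>x. x - 1) ` set xs"
  "xs \<noteq> [] \<Longrightarrow> hd (lower xs) = hd xs - 1" "xs \<noteq> [] \<Longrightarrow> last (lower xs) = last xs - 1"
  by (simp_all add: raise_def lower_def hd_map last_map comp_def)

lemma raise_inj [simp]: "raise xs = raise ys \<longleftrightarrow> xs = ys"
  by (metis lower_simps(6))

lemma slow_rise_Nil [simp]: "slow_rise []"
  by (simp add: slow_rise_def)

lemma slow_rise_Cons [simp]:
  "slow_rise (x # xs) \<longleftrightarrow> (xs \<noteq> [] \<longrightarrow> hd xs \<le> x + 1) \<and> slow_rise xs"
proof (cases xs)
  case (Cons y ys)
  have "slow_rise (x # y # ys) \<longleftrightarrow>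
      (\<forall>i<Suc (length ys). (x # y # ys) ! Suc i \<le> (x # y # ys) ! i + 1)"
    unfolding slow_rise_def by simp
  also have "\<dots> \<longleftrightarrow> y \<le> x + 1 \<and> slow_rise (y # ys)"
    unfolding slow_rise_def All_less_Suc2 by simp
  finally show ?thesis using Cons by simp
qed (simp add: slow_rise_def)

lemma slow_rise_append [simp]:
  "slow_rise (xs @ ys) \<longleftrightarrow>
     slow_rise xs \<and> slow_rise ys \<and> (xs \<noteq> [] \<and> ys \<noteq> [] \<longrightarrow> hd ys \<le> last xs + 1)"
  by (induction xs) (auto simp: hd_append)

lemma slow_rise_replicate [simp]: "slow_rise (replicate n x)"
  by (induction n) (auto simp: hd_replicate)

lemma slow_rise_raise [simp]: "slow_rise (raise v) = slow_rise v"
  by (induction v) auto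

lemma slow_rise_lower [simp]: "slow_rise (lower v) = slow_rise v"
  by (induction v) auto

lemma is_qdv_Nil [simp]: "\<not> is_qdv []"
  by (simp add: is_qdv_def)

lemma is_qdv_Cons [simp]: "is_qdv (x # v) \<longleftrightarrow> x = 0 \<and> (v \<noteq> [] \<longrightarrow> hd v \<le> 1) \<and> slow_rise v"
  by (auto simp: is_qdv_def)

lemma is_qdvE:
  assumes "is_qdv v" obtains V where "v = 0 # V" "V \<noteq> [] \<longrightarrow> hd V \<le> 1" "slow_rise V"
  using assms by (cases v) auto

lemma up_Cons [simp]: "up (x # v) = 0 # (x + 1) # raise v"
  by (simp add: up_def)

lemma up_inj [simp]: "up v = up w \<longleftrightarrow> v = w"
  by (simp add: up_def)

lemma length_up [simp]: "length (up v) = Suc (length v)"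
  by (simp add: up_def)

lemma length_up_funpow [simp]: "length ((up ^^ k) v) = k + length v"
  by (induction k) auto

lemma last_up_funpow: "v \<noteq> [] \<Longrightarrow> (up ^^ k) v \<noteq> [] \<and> last ((up ^^ k) v) = last v + int k"
  by (induction k) (auto simp: up_def)

lemma is_qdv_up: "is_qdv v \<Longrightarrow> is_qdv (up v)"
  by (auto elim!: is_qdvE simp: up_def)

lemma is_qdv_up_funpow: "is_qdv v \<Longrightarrow> is_qdv ((up ^^ k) v)"
  by (induction k) (auto intro: is_qdv_up)

lemma dyck_step_iff: "dyck_step v w \<longleftrightarrow> is_qdv v \<and> w = up v"
  using is_qdv_up by (auto simp: dyck_step_def up_def)

lemma dyck_class_eqI: "equivclp dyck_step v w \<Longrightarrow> dyck_class v = dyck_class w"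
  by (auto simp: dyck_class_def intro: equivclp_trans equivclp_sym)

lemma dyck_class_up [simp]:
  assumes "is_qdv v" shows "dyck_class (up v) = dyck_class v"
proof -
  have "equivclp dyck_step v (up v)"
    using assms by (simp add: dyck_step_iff r_into_equivclp)
  then show ?thesis by (simp add: dyck_class_eqI)
qed

lemma dyck_class_up_funpow [simp]: "is_qdv v \<Longrightarrow> dyck_class ((up ^^ k) v) = dyck_class v"
  by (induction k) (auto simp: is_qdv_up_funpow)

text \<open>An explicit form of the equivalence closure: \<open>up\<close> is injective, so every
  zigzag of steps collapses to a chain in one direction.\<close>

definition shifts :: "int list \<Rightarrow> int list \<Rightarrow> bool" where
  "shifts v w \<longleftrightarrow> (\<exists>k. w = (up ^^ k) v \<or> v = (up ^^ k) w)"

lemma shifts_up: "shifts v y \<Longrightarrow> shifts v (up y)"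
proof -
  assume "shifts v y"
  then obtain k where "y = (up ^^ k) v \<or> v = (up ^^ k) y"
    by (auto simp: shifts_def)
  then show ?thesis
  proof
    assume "y = (up ^^ k) v"
    then have "up y = (up ^^ Suc k) v" by simp
    then show ?thesis unfolding shifts_def by blast
  next
    assume v: "v = (up ^^ k) y"
    show ?thesis
    proof (cases k)
      case 0
      then have "up y = (up ^^ 1) v" using v by simp
      then show ?thesis unfolding shifts_def by blast
    next
      case (Suc j)
      then have "v = (up ^^ j) (up y)" using v by (simp add: funpow_swap1)
      then show ?thesis unfolding shifts_def by blast
    qed
  qed
qed

lemma shifts_up_down: "shifts v (up z) \<Longrightarrow> shifts v z"
proof -
  assume "shifts v (up z)"
  then obtain k where "up z = (up ^^ k) v \<or> v = (up ^^ k) (up z)"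
    by (auto simp: shifts_def)
  then show ?thesis
  proof
    assume z: "up z = (up ^^ k) v"
    show ?thesis
    proof (cases k)
      case 0
      then have "v = (up ^^ 1) z" using z by simp
      then show ?thesis unfolding shifts_def by blast
    next
      case (Suc j)
      then have "z = (up ^^ j) v" using z by simp
      then show ?thesis unfolding shifts_def by blast
    qed
  next
    assume "v = (up ^^ k) (up z)"
    then have "v = (up ^^ Suc k) z" by (simp add: funpow_swap1)
    then show ?thesis unfolding shifts_def by blast
  qed
qed

lemma equivclp_dyck_step: "equivclp dyck_step v w \<Longrightarrow> shifts v w"
proof (induction rule: equivclp_induct)
  case base
  have "v = (up ^^ 0) v" by simp
  then show ?case unfolding shifts_def by blast
next
  case (step y z)
  then show ?case by (auto simp: dyck_step_iff intro: shifts_up shifts_up_down)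
qed

lemma dyck_class_eqE:
  assumes "dyck_class v = dyck_class w"
  obtains k where "w = (up ^^ k) v" | k where "v = (up ^^ k) w"
proof -
  have "w \<in> dyck_class v" using assms by (simp add: dyck_class_def)
  then have "equivclp dyck_step v w" by (simp add: dyck_class_def)
  from equivclp_dyck_step[OF this] show ?thesis using that by (auto simp: shifts_def)
qed

text \<open>A representative of a class is of minimal length iff its second entry is not 1.\<close>

definition reduced :: "int list \<Rightarrow> bool" where
  "reduced v \<longleftrightarrow> is_qdv v \<and> (tl v \<noteq> [] \<longrightarrow> hd (tl v) \<le> 0)"

text \<open>A proper shift of a quasi-Dyck vector begins with 01, which \<open>reduced\<close>
  forbids.\<close>

lemma reduced_not_up:
  assumes "reduced v" "v = (up ^^ k) w" "is_qdv w" shows "k = 0"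
proof (cases k)
  case (Suc j)
  have "is_qdv ((up ^^ j) w)" using assms by (simp add: is_qdv_up_funpow)
  then have False using assms Suc by (auto simp: reduced_def elim!: is_qdvE)
  then show ?thesis ..
qed

lemma dyck_class_eq_reduced:
  assumes "dyck_class v = dyck_class w" "reduced v" "is_qdv w"
  obtains k where "w = (up ^^ k) v"
  using assms by (metis dyck_class_eqE reduced_not_up funpow_0)

lemma dyck_class_reduced: "reduced v \<Longrightarrow> dyck_class v = {(up ^^ k) v | k. True}"
proof (intro equalityI subsetI)
  fix w assume v: "reduced v" and w: "w \<in> dyck_class v"
  then have vw: "equivclp dyck_step v w" by (simp add: dyck_class_def)
  then have "is_qdv w"
  proof (induction rule: equivclp_induct)
    case base then show ?case using v by (simp add: reduced_def)
  qed (auto simp: dyck_step_iff is_qdv_up)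
  then obtain k where "w = (up ^^ k) v"
    by (rule dyck_class_eq_reduced[OF dyck_class_eqI[OF vw] v])
  then show "w \<in> {(up ^^ k) v | k. True}" by blast
next
  fix w assume "reduced v" "w \<in> {(up ^^ k) v | k. True}"
  then obtain k where "w = (up ^^ k) v" "is_qdv v" by (auto simp: reduced_def)
  then have "dyck_class w = dyck_class v" by simp
  moreover have "w \<in> dyck_class w" by (simp add: dyck_class_def)
  ultimately show "w \<in> dyck_class v" by simp
qed

section \<open>Partitions and the first rule\<close>

lemma part_Cons: "part (a # xs) i = (if i = 1 then a else if i = 0 then 0 else part xs (i - 1))"
  by (cases i) (auto simp: part_def nth_Cons split: nat.splits)

lemma part_map_diff: "part (map (\<lambda>x. x - 1) xs) i = part xs i - 1"
  by (auto simp: part_def)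

lemma part_eq_0: "\<forall>x\<in>set xs. x = 0 \<Longrightarrow> part xs i = 0"
  by (auto simp: part_def)

text \<open>In a weakly decreasing list the zeros form a suffix, so dropping them moves no
  index.\<close>

lemma part_filter_pos: "sorted_wrt (\<ge>) xs \<Longrightarrow> part (filter (\<lambda>x. x > 0) xs) i = part xs i"
proof (induction xs arbitrary: i)
  case (Cons a xs)
  then show ?case
    by (cases "a = 0") (auto simp: part_Cons part_eq_0)
qed simp

lemma part_antimono:
  assumes "is_partition \<gamma>" "1 \<le> i" "i \<le> j" shows "part \<gamma> j \<le> part \<gamma> i"
proof (cases "i = j")
  case False
  then have "i - 1 < j - 1" using assms by simp
  then show ?thesis
    using assms by (auto simp: part_def is_partition_def sorted_wrt_iff_nth_less)
qed simp

lemma part_pos: "is_partition \<gamma> \<Longrightarrow> 1 \<le> i \<Longrightarrow> i \<le> length \<gamma> \<Longrightarrow> part \<gamma> i > 0"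
  by (auto simp: part_def is_partition_def)

lemma length_qdv_of [simp]: "length (qdv_of n \<gamma>) = n"
  by (simp add: qdv_of_def)

lemma nth_qdv_of: "i < n \<Longrightarrow> qdv_of n \<gamma> ! i = int i - int (part \<gamma> (n - i))"
  by (simp add: qdv_of_def)

lemma qdv_of_Suc: "length \<gamma> < n \<Longrightarrow> qdv_of (Suc n) \<gamma> = up (qdv_of n \<gamma>)"
  by (rule nth_equalityI)
    (auto simp: nth_qdv_of up_def nth_Cons raise_def part_def split: nat.splits)

lemma is_qdv_qdv_of:
  assumes "is_partition \<gamma>" "length \<gamma> < n" shows "is_qdv (qdv_of n \<gamma>)"
  unfolding is_qdv_def
proof (intro conjI)
  show "qdv_of n \<gamma> \<noteq> []" using assms by (metis length_qdv_of list.size(3) not_less0)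
  then show "hd (qdv_of n \<gamma>) = 0"
    using assms by (simp add: hd_conv_nth nth_qdv_of part_def)
  have "part \<gamma> (n - i) \<le> part \<gamma> (n - Suc i)" if "Suc i < n" for i
    using that assms by (intro part_antimono) auto
  then show "slow_rise (qdv_of n \<gamma>)"
    by (auto simp: slow_rise_def nth_qdv_of)
qed

lemma reduced_qdv_of:
  assumes "is_partition \<gamma>" shows "reduced (qdv_of (Suc (length \<gamma>)) \<gamma>)"
  unfolding reduced_def
proof (intro conjI impI)
  let ?r = "qdv_of (Suc (length \<gamma>)) \<gamma>"
  show "is_qdv ?r" using assms by (simp add: is_qdv_qdv_of)
  assume ne: "tl ?r \<noteq> []"
  then have "length (tl ?r) > 0" by blast
  then have l: "length \<gamma> > 0" by simp
  have "hd (tl ?r) = ?r ! 1" using ne by (cases ?r) (simp_all add: hd_conv_nth)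
  also have "\<dots> = 1 - int (part \<gamma> (length \<gamma>))" using l by (simp add: nth_qdv_of)
  finally show "hd (tl ?r) \<le> 0" using part_pos[OF assms, of "length \<gamma>"] l by simp
qed

lemma qdv_of_add:
  "length \<gamma> < n \<Longrightarrow> qdv_of (n + k) \<gamma> = (up ^^ k) (qdv_of n \<gamma>)"
  by (induction k) (auto simp: qdv_of_Suc)

lemma class_of_eq:
  assumes "is_partition \<gamma>" shows "class_of \<gamma> = dyck_class (qdv_of (Suc (length \<gamma>)) \<gamma>)"
proof -
  have "class_of \<gamma> = {(up ^^ k) (qdv_of (Suc (length \<gamma>)) \<gamma>) | k. True}"
    unfolding class_of_def
    by (auto simp: qdv_of_add[symmetric] dest!: less_imp_Suc_add)
  then show ?thesis by (simp add: dyck_class_reduced[OF reduced_qdv_of[OF assms]])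
qed

lemma class_of_eq_qdv_of:
  assumes "is_partition \<gamma>" "length \<gamma> < n" shows "class_of \<gamma> = dyck_class (qdv_of n \<gamma>)"
proof -
  obtain k where "n = Suc (length \<gamma>) + k" using assms less_imp_Suc_add by auto
  then show ?thesis
    using assms qdv_of_add[of \<gamma> "Suc (length \<gamma>)" k] by (simp add: class_of_eq is_qdv_qdv_of)
qed

lemma reduced_unique:
  assumes "dyck_class v = dyck_class w" "reduced v" "reduced w" shows "v = w"
proof -
  obtain k where k: "w = (up ^^ k) v"
    using dyck_class_eq_reduced[OF assms(1,2)] assms(3) by (auto simp: reduced_def)
  then have "k = 0" using reduced_not_up assms by (auto simp: reduced_def)
  then show ?thesis using k by simp
qed

lemma class_of_inj:
  assumes "is_partition \<gamma>" "is_partition \<delta>" "class_of \<gamma> = class_of \<delta>" shows "\<gamma> = \<delta>"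
proof -
  have eq: "qdv_of (Suc (length \<gamma>)) \<gamma> = qdv_of (Suc (length \<delta>)) \<delta>"
    using assms by (intro reduced_unique) (simp_all add: reduced_qdv_of class_of_eq)
  then have l: "length \<gamma> = length \<delta>" by (metis length_qdv_of nat.inject)
  have "\<gamma> ! i = \<delta> ! i" if i: "i < length \<gamma>" for i
  proof -
    have "qdv_of (Suc (length \<gamma>)) \<gamma> ! (length \<gamma> - i) = qdv_of (Suc (length \<delta>)) \<delta> ! (length \<gamma> - i)"
      using eq by simp
    then show ?thesis using i l by (simp add: nth_qdv_of part_def)
  qed
  then show ?thesis using l by (simp add: nth_equalityI)
qed

lemma partition_of_class_of: "is_partition \<gamma> \<Longrightarrow> partition_of (class_of \<gamma>) = \<gamma>"
  unfolding partition_of_def by (rule the_equality) (auto intro: class_of_inj)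

lemma slow_rise_nth:
  assumes "slow_rise v" "i \<le> j" "j < length v" shows "v ! j \<le> v ! i + int (j - i)"
  using assms(2,3)
proof (induction j rule: dec_induct)
  case (step j)
  then show ?case using assms(1) by (force simp: slow_rise_def Suc_diff_le)
qed simp

text \<open>The parts are the differences \<open>i - r ! i\<close> read from right to left. Slow
  rise makes them monotone; a second entry at most 0 makes all of them positive, so that none is
  lost as a part.\<close>

lemma reduced_eq_qdv_of:
  assumes "reduced r"
  obtains \<gamma> where "is_partition \<gamma>" "qdv_of (Suc (length \<gamma>)) \<gamma> = r"
proof -
  define f where "f i = nat (int i - r ! i)" for i
  define \<gamma> where "\<gamma> = map (\<lambda>j. f (length r - 1 - j)) [0..<length r - 1]"
  have r: "is_qdv r" "r \<noteq> []" "slow_rise r" "r ! 0 = 0"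
    using assms by (auto simp: reduced_def elim!: is_qdvE)
  have pos: "r ! i < int i" if "0 < i" "i < length r" for i
  proof -
    have "tl r \<noteq> []" using that by (cases r) auto
    then have "r ! 1 \<le> 0" using assms by (cases r) (auto simp: reduced_def hd_conv_nth)
    then show ?thesis using slow_rise_nth[OF r(3), of 1 i] that by (auto simp: of_nat_diff)
  qed
  have mono: "f i \<le> f j" if "i \<le> j" "j < length r" for i j
    unfolding f_def using slow_rise_nth[OF r(3) that] that by (intro nat_mono) (simp add: of_nat_diff)
  have l: "length \<gamma> = length r - 1" by (simp add: \<gamma>_def)
  have "is_partition \<gamma>"
    unfolding is_partition_def
  proof
    show "sorted_wrt (\<ge>) \<gamma>"
      unfolding sorted_wrt_iff_nth_less using mono by (auto simp: \<gamma>_def)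
    have "f (length r - 1 - j) > 0" if "j < length r - 1" for j
      using pos[of "length r - 1 - j"] that by (simp add: f_def)
    then show "\<forall>x\<in>set \<gamma>. x > 0" by (auto simp: \<gamma>_def)
  qed
  moreover have "qdv_of (Suc (length \<gamma>)) \<gamma> = r"
  proof (rule nth_equalityI)
    show "length (qdv_of (Suc (length \<gamma>)) \<gamma>) = length r" using l r(2) by (simp add: Suc_leI)
    fix i assume "i < length (qdv_of (Suc (length \<gamma>)) \<gamma>)"
    then have i: "i < length r" using l r(2) by (cases r) auto
    show "qdv_of (Suc (length \<gamma>)) \<gamma> ! i = r ! i"
    proof (cases "i = 0")
      case True
      then show ?thesis using r(4) by (simp add: nth_qdv_of part_def)
    next
      case False
      then show ?thesis using i pos[of i] by (auto simp: nth_qdv_of part_def l \<gamma>_def f_def)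
    qed
  qed
  ultimately show ?thesis using that by blast
qed

text \<open>At length \<open>length \<gamma> + 2\<close> the new first part becomes the final 0, and
  diminishing each old part by 1 while moving it one place to the right in the index raises the old
  entry by 1.\<close>

lemma NU1_class_of:
  assumes \<gamma>: "is_partition \<gamma>" and le: "part \<gamma> 1 \<le> length \<gamma> + 2"
    and V: "qdv_of (Suc (length \<gamma>)) \<gamma> = 0 # V"
  shows "NU1 (class_of \<gamma>) = dyck_class (0 # raise V @ [0])"
proof -
  define \<delta> where "\<delta> = (length \<gamma> + 1) # filter (\<lambda>x. x > 0) (map (\<lambda>x. x - 1) \<gamma>)"
  \<comment> \<open>Dropping zero parts only shortens \<open>\<delta>\<close>, so this length still
    represents its class.\<close>
  have len: "length \<delta> < length \<gamma> + 2"
    unfolding \<delta>_def using length_filter_le[of "\<lambda>x. x > 0" "map (\<lambda>x. x - 1) \<gamma>"]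
    by (simp del: filter_map length_filter_map)
  have sorted: "sorted_wrt (\<ge>) (map (\<lambda>x. x - 1) \<gamma>)"
    using \<gamma> unfolding is_partition_def
    by (auto simp: sorted_wrt_map intro: sorted_wrt_mono_rel[rotated] diff_le_mono)
  have "x - 1 \<le> length \<gamma> + 1" if x: "x \<in> set \<gamma>" for x
  proof -
    obtain i where "i < length \<gamma>" "x = \<gamma> ! i" using x by (metis in_set_conv_nth)
    then have "x = part \<gamma> (Suc i)" by (simp add: part_def)
    then show ?thesis using part_antimono[OF \<gamma>, of 1 "Suc i"] le by simp
  qed
  then have \<delta>: "is_partition \<delta>"
    using sorted by (auto simp: is_partition_def \<delta>_def sorted_wrt_filter)
  have part\<delta>: "part \<delta> i = (if i = 1 then length \<gamma> + 1 else part \<gamma> (i - 1) - 1)" if "i \<ge> 1" for i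
    using that by (auto simp: \<delta>_def part_Cons part_filter_pos[OF sorted] part_map_diff simp del: One_nat_def)
  have lV: "length V = length \<gamma>" using arg_cong[OF V, of length] by simp
  have nV: "V ! i = int (Suc i) - int (part \<gamma> (length \<gamma> - i))" if "i < length \<gamma>" for i
    using nth_qdv_of[of "Suc i" "Suc (length \<gamma>)" \<gamma>] V that by simp
  have "qdv_of (length \<gamma> + 2) \<delta> = 0 # raise V @ [0]"
  proof (rule nth_equalityI)
    fix i assume i: "i < length (qdv_of (length \<gamma> + 2) \<delta>)"
    consider "i = 0" | j where "i = Suc j" "j < length \<gamma>" | "i = Suc (length \<gamma>)"
      using i by (cases i) (auto simp: less_Suc_eq)
    then show "qdv_of (length \<gamma> + 2) \<delta> ! i = (0 # raise V @ [0]) ! i"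
    proof cases
      case 1
      then show ?thesis by (simp add: nth_qdv_of part\<delta>) (simp add: part_def)
    next
      case 2
      have "part \<gamma> (length \<gamma> - j) > 0" using 2 \<gamma> by (intro part_pos) auto
      then show ?thesis using 2 nV[of j] lV
        by (auto simp: nth_qdv_of part\<delta> nth_append raise_def of_nat_diff Suc_diff_le)
    next
      case 3
      then show ?thesis by (simp add: nth_qdv_of part\<delta> nth_append lV)
    qed
  qed (simp add: lV)
  then have "class_of \<delta> = dyck_class (0 # raise V @ [0])"
    using class_of_eq_qdv_of[OF \<delta> len] by simp
  then show ?thesis by (simp add: NU1_def partition_of_class_of[OF \<gamma>] \<delta>_def)
qed

lemma last_qdv_of:
  assumes "qdv_of (Suc (length \<gamma>)) \<gamma> = 0 # V" "V \<noteq> []"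
  shows "last V = int (length \<gamma>) - int (part \<gamma> 1)"
proof -
  let ?r = "qdv_of (Suc (length \<gamma>)) \<gamma>"
  have "last V = last ?r" using assms by simp
  also have "\<dots> = ?r ! length \<gamma>"
    using assms(1) length_qdv_of[of "Suc (length \<gamma>)" \<gamma>] by (subst last_conv_nth) auto
  finally show ?thesis by (simp add: nth_qdv_of)
qed

text \<open>The reduced representative \<open>0 # lower U\<close> ends in
  \<open>length \<gamma> - part \<gamma> 1\<close>. Hence the bound defining \<open>D1\<close> says
  that \<open>U\<close> ends in at least -1, which is exactly the condition for appending a
  0.\<close>

lemma NU1_dyck_class:
  assumes "is_qdv (0 # U @ [0])"
  shows "dyck_class (0 # 1 # U) \<in> D1" "NU1 (dyck_class (0 # 1 # U)) = dyck_class (0 # U @ [0])"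
proof -
  let ?r = "0 # lower U"
  have "reduced ?r" using assms by (auto simp: reduced_def hd_append)
  then obtain \<gamma> where \<gamma>: "is_partition \<gamma>" "qdv_of (Suc (length \<gamma>)) \<gamma> = ?r"
    by (rule reduced_eq_qdv_of)
  have "is_qdv ?r" using \<open>reduced ?r\<close> by (simp add: reduced_def)
  from dyck_class_up[OF this] have c: "class_of \<gamma> = dyck_class (0 # 1 # U)"
    using \<gamma> by (simp add: class_of_eq)
  have "part \<gamma> 1 \<le> length \<gamma> + 2"
  proof (cases "U = []")
    case True
    then have "length \<gamma> = 0" using arg_cong[OF \<gamma>(2), of length] by simp
    then show ?thesis by (simp add: part_def)
  next
    case False
    then show ?thesis using assms last_qdv_of[OF \<gamma>(2)] by simp
  qed
  then show "dyck_class (0 # 1 # U) \<in> D1" "NU1 (dyck_class (0 # 1 # U)) = dyck_class (0 # U @ [0])"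
    using \<gamma> c NU1_class_of[OF \<gamma>(1) _ \<gamma>(2)] unfolding D1_def by auto
qed

lemma D1E:
  assumes "c \<in> D1"
  obtains U where "is_qdv (0 # U @ [0])" "c = dyck_class (0 # 1 # U)"
proof -
  obtain \<gamma> where \<gamma>: "is_partition \<gamma>" "part \<gamma> 1 \<le> length \<gamma> + 2" "c = class_of \<gamma>"
    using assms by (auto simp: D1_def)
  let ?r = "qdv_of (Suc (length \<gamma>)) \<gamma>"
  have r: "reduced ?r" "is_qdv ?r" using reduced_qdv_of[OF \<gamma>(1)] by (auto simp: reduced_def)
  then obtain V where V: "?r = 0 # V" by (auto elim: is_qdvE)
  have "last V \<ge> -2" if "V \<noteq> []" using last_qdv_of[OF V that] \<gamma>(2) by simp
  then have "is_qdv (0 # raise V @ [0])"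
    using r V by (auto simp: reduced_def hd_append)
  moreover have "c = dyck_class (up ?r)" using \<gamma> r by (simp add: class_of_eq)
  ultimately show ?thesis using that[of "raise V"] unfolding V up_Cons by simp
qed

section \<open>The combined map NU\<close>

definition lead :: "'a \<Rightarrow> 'a list \<Rightarrow> nat" where
  "lead x v = length (takeWhile (\<lambda>y. y = x) v)"

definition trail :: "'a \<Rightarrow> 'a list \<Rightarrow> nat" where
  "trail x v = lead x (rev v)"

lemma lead_Nil [simp]: "lead x [] = 0"
  by (simp add: lead_def)

lemma lead_Cons [simp]: "lead x (y # v) = (if y = x then Suc (lead x v) else 0)"
  by (simp add: lead_def)

lemma lead_replicate_append [simp]:
  "lead x (replicate n y @ v) = (if y = x \<or> n = 0 then n + lead x v else 0)"
  by (induction n) auto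

lemma lead_replicate [simp]: "lead x (replicate n y) = (if y = x then n else 0)"
  by (induction n) auto

lemma lead_append_0 [simp]: "u \<noteq> [] \<Longrightarrow> hd u \<noteq> x \<Longrightarrow> lead x (u @ v) = 0"
  by (cases u) auto

text \<open>
  In rule (a), \<open>h\<close> is read off the source as one more than the number of trailing entries \<open>-1\<close> and
  off the target as the number of leading zeros; in rule (b), \<open>k\<close> is the number of twos after
  \<open>01\<close> in the source and of trailing ones in the target.
\<close>

definition src_a :: "nat \<Rightarrow> int list \<Rightarrow> int list" where
  "src_a h A = (([0, 1] @ replicate h 2) @ A) @ replicate (h - 1) (-1)"

definition tgt_a :: "nat \<Rightarrow> int list \<Rightarrow> int list" where
  "tgt_a h A = ((replicate h 0 @ [1]) @ A) @ replicate h 1"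

definition src_b :: "nat \<Rightarrow> int list \<Rightarrow> int list" where
  "src_b k B = (([0, 1] @ replicate k 2) @ B) @ replicate k (-1)"

definition tgt_b :: "nat \<Rightarrow> int list \<Rightarrow> int list" where
  "tgt_b k B = ((replicate (Suc k) 0 @ B) @ [0]) @ replicate k 1"

definition ok_a :: "nat \<Rightarrow> int list \<Rightarrow> bool" where
  "ok_a h A \<longleftrightarrow> h \<ge> 2 \<and> (A \<noteq> [] \<longrightarrow> (\<forall>x\<in>set A. x \<le> 2) \<and> last A \<ge> 0 \<and> slow_rise A)"

definition ok_b :: "nat \<Rightarrow> int list \<Rightarrow> bool" where
  "ok_b k B \<longleftrightarrow> k \<ge> 1 \<and>
     (B \<noteq> [] \<longrightarrow> (\<forall>x\<in>set B. x \<le> 2) \<and> hd B \<le> 1 \<and> last B \<ge> -1 \<and> slow_rise B)"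

lemma NU2_rule_iff:
  "NU2_rule c d \<longleftrightarrow>
     (\<exists>h A. ok_a h A \<and> c = dyck_class (src_a h A) \<and> d = dyck_class (tgt_a h A)) \<or>
     (\<exists>k B. ok_b k B \<and> c = dyck_class (src_b k B) \<and> d = dyck_class (tgt_b k B))"
proof -
  have a: "[0] @ replicate (h - 1) 0 @ [1] @ A @ replicate h 1 = tgt_a h A" if "h \<ge> 2" for h A
    using that by (cases h) (auto simp: tgt_a_def)
  have b: "[0] @ replicate k 0 @ B @ [0] @ replicate k 1 = tgt_b k B" for k B
    by (simp add: tgt_b_def)
  show ?thesis
  proof
    assume "NU2_rule c d"
    then show "(\<exists>h A. ok_a h A \<and> c = dyck_class (src_a h A) \<and> d = dyck_class (tgt_a h A)) \<or>
        (\<exists>k B. ok_b k B \<and> c = dyck_class (src_b k B) \<and> d = dyck_class (tgt_b k B))"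
    proof cases
      case (rule_a h A)
      then have "ok_a h A" "c = dyck_class (src_a h A)" "d = dyck_class (tgt_a h A)"
        by (simp_all add: ok_a_def src_a_def flip: a)
      then show ?thesis by blast
    next
      case (rule_b k B)
      then have "ok_b k B" "c = dyck_class (src_b k B)" "d = dyck_class (tgt_b k B)"
        by (simp_all add: ok_b_def src_b_def flip: b)
      then show ?thesis by blast
    qed
  next
    assume "(\<exists>h A. ok_a h A \<and> c = dyck_class (src_a h A) \<and> d = dyck_class (tgt_a h A)) \<or>
        (\<exists>k B. ok_b k B \<and> c = dyck_class (src_b k B) \<and> d = dyck_class (tgt_b k B))"
    then show "NU2_rule c d"
    proof (elim disjE exE conjE)
      fix h A assume *: "ok_a h A" "c = dyck_class (src_a h A)" "d = dyck_class (tgt_a h A)"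
      then have "h \<ge> 2" by (simp add: ok_a_def)
      from NU2_rule.rule_a[of h A, unfolded a[OF this]] show ?thesis
        using * by (simp add: ok_a_def src_a_def)
    next
      fix k B assume *: "ok_b k B" "c = dyck_class (src_b k B)" "d = dyck_class (tgt_b k B)"
      from NU2_rule.rule_b[of k B, unfolded b] show ?thesis
        using * by (simp add: ok_b_def src_b_def)
    qed
  qed
qed

lemma hd_le_ok_a: "ok_a h A \<Longrightarrow> A = [] \<or> hd A \<le> 3"
  by (cases A) (auto simp: ok_a_def)

lemma is_qdv_src_a: "ok_a h A \<Longrightarrow> is_qdv (src_a h A)"
  by (frule hd_le_ok_a, cases "A = []") (auto simp: ok_a_def src_a_def hd_append last_append hd_replicate)

lemma is_qdv_tgt_a: "ok_a h A \<Longrightarrow> is_qdv (tgt_a h A)"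
  by (frule hd_le_ok_a, cases h; cases "A = []") (auto simp: ok_a_def tgt_a_def hd_append last_append hd_replicate)

lemma is_qdv_src_b: "ok_b k B \<Longrightarrow> is_qdv (src_b k B)"
  by (cases "B = []") (auto simp: ok_b_def src_b_def hd_append last_append hd_replicate)

lemma is_qdv_tgt_b: "ok_b k B \<Longrightarrow> is_qdv (tgt_b k B)"
  by (cases "B = []") (auto simp: ok_b_def tgt_b_def hd_append last_append hd_replicate)

text \<open>
  On lists, \<open>NU\<^sub>1\<close> is a rotation: a 1 after the initial 0 is moved to the end and lowered.
\<close>

inductive NU_rule :: "int list set \<Rightarrow> int list set \<Rightarrow> bool" where
  rotate: "is_qdv (0 # U @ [0]) \<Longrightarrow> NU_rule (dyck_class (0 # 1 # U)) (dyck_class (0 # U @ [0]))"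
| rule_a: "ok_a h A \<Longrightarrow> NU_rule (dyck_class (src_a h A)) (dyck_class (tgt_a h A))"
| rule_b: "ok_b k B \<Longrightarrow> NU_rule (dyck_class (src_b k B)) (dyck_class (tgt_b k B))"

text \<open>Each shift adds 1 to the last letter, so representatives with equal last letters differ
  by no shift.\<close>

lemma dyck_class_eq_last:
  assumes "dyck_class v = dyck_class w" "last v = last w" "v \<noteq> []" "w \<noteq> []" shows "v = w"
  using assms(1)
proof (rule dyck_class_eqE)
  fix k assume "w = (up ^^ k) v" then show ?thesis using last_up_funpow[of v k] assms by simp
next
  fix k assume "v = (up ^^ k) w" then show ?thesis using last_up_funpow[of w k] assms by simp
qed

text \<open>All sources end in -1 and all targets in 1, so \<open>dyck_class_eq_last\<close> allows
  the rules (a) and (b) to be compared as lists.\<close>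

lemma last_rules:
  "ok_a h A \<Longrightarrow> last (src_a h A) = -1" "ok_b k B \<Longrightarrow> last (src_b k B) = -1"
  "ok_a h A \<Longrightarrow> last (tgt_a h A) = 1" "ok_b k B \<Longrightarrow> last (tgt_b k B) = 1"
  by (simp_all add: ok_a_def ok_b_def src_a_def src_b_def tgt_a_def tgt_b_def last_append)

lemma rules_nonempty [simp]:
  "src_a h A \<noteq> []" "src_b k B \<noteq> []" "tgt_a h A \<noteq> []" "tgt_b k B \<noteq> []"
  by (simp_all add: src_a_def src_b_def tgt_a_def tgt_b_def)

lemma trail_src_a: "ok_a h A \<Longrightarrow> trail (-1) (src_a h A) = h - 1"
  unfolding src_a_def trail_def by (cases "A = []") (auto simp: ok_a_def hd_rev)

lemma lead_tgt_a: "lead 0 (tgt_a h A) = h"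
  by (simp add: tgt_a_def)

lemma lead_src_b: "ok_b k B \<Longrightarrow> lead 2 (drop 2 (src_b k B)) = k"
  by (cases k; cases "B = []") (auto simp: src_b_def ok_b_def)

lemma trail_tgt_b: "trail 1 (tgt_b k B) = k"
  by (simp add: trail_def tgt_b_def)

lemma lead_src_a: "lead 2 (drop 2 (src_a h A)) \<ge> h"
  by (simp add: src_a_def)

lemma trail_src_b: "trail (-1) (src_b k B) \<ge> k"
  by (simp add: trail_def src_b_def)

lemma trail_tgt_a: "trail 1 (tgt_a h A) \<ge> h"
  by (simp add: trail_def tgt_a_def)

lemma lead_tgt_b: "lead 0 (tgt_b k B) \<ge> Suc k"
  by (simp add: tgt_b_def)

text \<open>A source of (a) has more twos after 01 than final entries -1, a source of (b) at most as
  many; this separates the two rules.\<close>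

lemma src_inj:
  "ok_a h A \<Longrightarrow> ok_a h' A' \<Longrightarrow> src_a h A = src_a h' A' \<Longrightarrow> h = h' \<and> A = A'"
  "ok_b k B \<Longrightarrow> ok_b k' B' \<Longrightarrow> src_b k B = src_b k' B' \<Longrightarrow> k = k' \<and> B = B'"
  "ok_a h A \<Longrightarrow> ok_b k B \<Longrightarrow> src_a h A \<noteq> src_b k B"
proof -
  assume *: "ok_a h A" "ok_a h' A'" "src_a h A = src_a h' A'"
  have "h - 1 = h' - 1" using trail_src_a[OF *(1)] trail_src_a[OF *(2)] *(3) by simp
  then have "h = h'" using * by (auto simp: ok_a_def)
  then show "h = h' \<and> A = A'" using * by (simp add: src_a_def)
next
  assume *: "ok_b k B" "ok_b k' B'" "src_b k B = src_b k' B'"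
  have "k = k'" using lead_src_b[OF *(1)] lead_src_b[OF *(2)] *(3) by simp
  then show "k = k' \<and> B = B'" using * by (simp add: src_b_def)
next
  assume *: "ok_a h A" "ok_b k B"
  show "src_a h A \<noteq> src_b k B"
    using trail_src_a[OF *(1)] lead_src_a[of h A] trail_src_b[of k B] lead_src_b[OF *(2)] *
    by (auto simp: ok_a_def)
qed

text \<open>A target of (a) has at most as many leading zeros as final ones, a target of (b) has
  more.\<close>

lemma tgt_inj:
  "ok_a h A \<Longrightarrow> ok_a h' A' \<Longrightarrow> tgt_a h A = tgt_a h' A' \<Longrightarrow> h = h' \<and> A = A'"
  "ok_b k B \<Longrightarrow> ok_b k' B' \<Longrightarrow> tgt_b k B = tgt_b k' B' \<Longrightarrow> k = k' \<and> B = B'"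
  "ok_a h A \<Longrightarrow> ok_b k B \<Longrightarrow> tgt_a h A \<noteq> tgt_b k B"
proof -
  assume *: "tgt_a h A = tgt_a h' A'"
  then have "h = h'" using lead_tgt_a by metis
  then show "h = h' \<and> A = A'" using * by (simp add: tgt_a_def)
next
  assume *: "tgt_b k B = tgt_b k' B'"
  then have "k = k'" using trail_tgt_b by metis
  then show "k = k' \<and> B = B'" using * by (simp add: tgt_b_def)
next
  show "tgt_a h A \<noteq> tgt_b k B"
    using trail_tgt_a[of h A] lead_tgt_b[of k B] trail_tgt_b[of k B] lead_tgt_a[of h A] by auto
qed

lemma up_funpow_eq_01:
  assumes "0 # 1 # W = (up ^^ k) (0 # 1 # U)" "W \<noteq> [] \<longrightarrow> hd W \<le> 1" shows "k = 0"
proof (rule ccontr)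
  assume "k \<noteq> 0"
  then have "\<exists>Z. (up ^^ k) (0 # 1 # U) = 0 # 1 # 2 # Z"
  proof (induction k)
    case (Suc k) then show ?case by (cases k) auto
  qed simp
  then show False using assms by auto
qed

lemma hd_rotate: "is_qdv (0 # U @ [0]) \<Longrightarrow> U \<noteq> [] \<longrightarrow> hd U \<le> 1"
  by (auto simp: hd_append)

lemma rotate_src_unique:
  assumes eq: "dyck_class (0 # 1 # U) = dyck_class (0 # 1 # W)"
    and U: "is_qdv (0 # U @ [0])" and W: "is_qdv (0 # W @ [0])"
  shows "U = W"
  using eq
proof (rule dyck_class_eqE)
  fix k assume "0 # 1 # W = (up ^^ k) (0 # 1 # U)"
  then show ?thesis using up_funpow_eq_01[OF _ hd_rotate[OF W]] by fastforce
next
  fix k assume "0 # 1 # U = (up ^^ k) (0 # 1 # W)"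
  then show ?thesis using up_funpow_eq_01[OF _ hd_rotate[OF U]] by fastforce
qed

text \<open>The last letter rules out that the right-hand list is a proper shift of the left one,
  the third letter rules out the converse. Equality as lists would make \<open>U\<close> begin with
  2.\<close>

lemma rotate_src_neq:
  assumes U: "is_qdv (0 # U @ [0])" and W: "last (2 # W) = -1"
  shows "dyck_class (0 # 1 # U) \<noteq> dyck_class (0 # 1 # 2 # W)"
proof
  assume "dyck_class (0 # 1 # U) = dyck_class (0 # 1 # 2 # W)"
  then show False
  proof (rule dyck_class_eqE)
    fix k assume k: "0 # 1 # 2 # W = (up ^^ k) (0 # 1 # U)"
    have "last (0 # 1 # U) \<ge> -1" using U by auto
    moreover have "last (0 # 1 # 2 # W) = last (0 # 1 # U) + int k"
      unfolding k by (rule conjunct2[OF last_up_funpow]) simp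
    ultimately have "k = 0" using W by (auto split: if_splits)
    then show False using k U by (auto simp: hd_append)
  next
    fix k assume k: "0 # 1 # U = (up ^^ k) (0 # 1 # 2 # W)"
    then have "k = 0" by (rule up_funpow_eq_01[OF _ hd_rotate[OF U]])
    then show False using k U by (auto simp: hd_append)
  qed
qed

text \<open>A list beginning with 00 is reduced, hence no proper shift; and its own shifts end in at
  least 1, never in 0.\<close>

lemma rotate_tgt_neq:
  assumes "is_qdv (0 # U @ [0])" "is_qdv (0 # 0 # W)" "last (0 # W) \<ge> 1"
  shows "dyck_class (0 # U @ [0]) \<noteq> dyck_class (0 # 0 # W)"
proof
  assume "dyck_class (0 # U @ [0]) = dyck_class (0 # 0 # W)"
  then show False
  proof (rule dyck_class_eqE)
    fix k assume k: "0 # 0 # W = (up ^^ k) (0 # U @ [0])"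
    have "k = 0"
    proof (rule reduced_not_up[OF _ k assms(1)])
      show "reduced (0 # 0 # W)" using assms(2) by (simp add: reduced_def)
    qed
    then have "last (0 # 0 # W) = 0" using k by simp
    then show False using assms(3) by (auto split: if_splits)
  next
    fix k assume "0 # U @ [0] = (up ^^ k) (0 # 0 # W)"
    then have "last (0 # U @ [0]) = last (0 # 0 # W) + int k"
      using last_up_funpow[of "0 # 0 # W" k] by simp
    then show False using assms(3) by (auto split: if_splits)
  qed
qed

lemma src_a_Cons: "ok_a h A \<Longrightarrow> \<exists>W. src_a h A = 0 # 1 # 2 # W \<and> last (2 # W) = -1"
  using last_rules(1)[of h A] by (cases h) (auto simp: src_a_def ok_a_def)

lemma src_b_Cons: "ok_b k B \<Longrightarrow> \<exists>W. src_b k B = 0 # 1 # 2 # W \<and> last (2 # W) = -1"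
  using last_rules(2)[of k B] by (cases k) (auto simp: src_b_def ok_b_def)

lemma tgt_a_Cons: "ok_a h A \<Longrightarrow> \<exists>W. tgt_a h A = 0 # 0 # W \<and> last (0 # W) = 1"
  using last_rules(3)[of h A] by (cases h; cases "h - 1") (auto simp: tgt_a_def ok_a_def)

lemma tgt_b_Cons: "ok_b k B \<Longrightarrow> \<exists>W. tgt_b k B = 0 # 0 # W \<and> last (0 # W) = 1"
  using last_rules(4)[of k B] by (cases k) (auto simp: tgt_b_def ok_b_def)

lemma rotate_src_neq_a:
  "is_qdv (0 # U @ [0]) \<Longrightarrow> ok_a h A \<Longrightarrow> dyck_class (0 # 1 # U) \<noteq> dyck_class (src_a h A)"
  using rotate_src_neq src_a_Cons by metis

lemma rotate_src_neq_b:
  "is_qdv (0 # U @ [0]) \<Longrightarrow> ok_b k B \<Longrightarrow> dyck_class (0 # 1 # U) \<noteq> dyck_class (src_b k B)"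
  using rotate_src_neq src_b_Cons by metis

lemma rotate_tgt_neq_a:
  "is_qdv (0 # U @ [0]) \<Longrightarrow> ok_a h A \<Longrightarrow> dyck_class (0 # U @ [0]) \<noteq> dyck_class (tgt_a h A)"
  using rotate_tgt_neq tgt_a_Cons is_qdv_tgt_a by (metis order_refl)

lemma rotate_tgt_neq_b:
  "is_qdv (0 # U @ [0]) \<Longrightarrow> ok_b k B \<Longrightarrow> dyck_class (0 # U @ [0]) \<noteq> dyck_class (tgt_b k B)"
  using rotate_tgt_neq tgt_b_Cons is_qdv_tgt_b by (metis order_refl)

lemma src_class_inj:
  "ok_a h A \<Longrightarrow> ok_a h' A' \<Longrightarrow> dyck_class (src_a h A) = dyck_class (src_a h' A') \<Longrightarrow> h = h' \<and> A = A'"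
  "ok_b k B \<Longrightarrow> ok_b k' B' \<Longrightarrow> dyck_class (src_b k B) = dyck_class (src_b k' B') \<Longrightarrow> k = k' \<and> B = B'"
  "ok_a h A \<Longrightarrow> ok_b k B \<Longrightarrow> dyck_class (src_a h A) \<noteq> dyck_class (src_b k B)"
  using src_inj dyck_class_eq_last last_rules rules_nonempty by metis+

lemma tgt_class_inj:
  "ok_a h A \<Longrightarrow> ok_a h' A' \<Longrightarrow> dyck_class (tgt_a h A) = dyck_class (tgt_a h' A') \<Longrightarrow> h = h' \<and> A = A'"
  "ok_b k B \<Longrightarrow> ok_b k' B' \<Longrightarrow> dyck_class (tgt_b k B) = dyck_class (tgt_b k' B') \<Longrightarrow> k = k' \<and> B = B'"
  "ok_a h A \<Longrightarrow> ok_b k B \<Longrightarrow> dyck_class (tgt_a h A) \<noteq> dyck_class (tgt_b k B)"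
  using tgt_inj dyck_class_eq_last last_rules rules_nonempty by metis+

lemma NU_rule_functional:
  assumes "NU_rule c d" "NU_rule c d'" shows "d = d'"
  using assms
  by (auto elim!: NU_rule.cases dest: src_class_inj rotate_src_unique
      simp: rotate_src_neq_a rotate_src_neq_b rotate_src_neq_a[symmetric] rotate_src_neq_b[symmetric]
        src_class_inj(3) src_class_inj(3)[symmetric])

lemma rotate_tgt_unique:
  "dyck_class (0 # U @ [0]) = dyck_class (0 # W @ [0]) \<Longrightarrow> U = W"
  using dyck_class_eq_last[of "0 # U @ [0]" "0 # W @ [0]"] by simp

lemma NU_rule_injective:
  assumes "NU_rule c d" "NU_rule c' d" shows "c = c'"
  using assms
  by (auto elim!: NU_rule.cases dest: tgt_class_inj rotate_tgt_unique
      simp: rotate_tgt_neq_a rotate_tgt_neq_b rotate_tgt_neq_a[symmetric] rotate_tgt_neq_b[symmetric]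
        tgt_class_inj(3) tgt_class_inj(3)[symmetric])

lemma NU2_rule_NU_rule: "NU2_rule c d \<Longrightarrow> NU_rule c d"
  by (auto simp: NU2_rule_iff intro: NU_rule.intros)

lemma D1_iff: "c \<in> D1 \<longleftrightarrow> (\<exists>U. is_qdv (0 # U @ [0]) \<and> c = dyck_class (0 # 1 # U))"
  using D1E NU1_dyck_class(1) by metis

lemma NU_rule_iff:
  "NU_rule c d \<longleftrightarrow>
     (\<exists>U. is_qdv (0 # U @ [0]) \<and> c = dyck_class (0 # 1 # U) \<and> d = dyck_class (0 # U @ [0])) \<or> NU2_rule c d"
  unfolding NU_rule.simps NU2_rule_iff by blast

lemma NU_dom_iff: "c \<in> NU_dom \<longleftrightarrow> (\<exists>d. NU_rule c d)"
  unfolding NU_dom_def D2_def NU_rule_iff Un_iff D1_iff mem_Collect_eq by blast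

lemma NU_eq:
  assumes "NU_rule c d" shows "NU c = d"
proof (cases "c \<in> D1")
  case True
  then obtain U where "is_qdv (0 # U @ [0])" "c = dyck_class (0 # 1 # U)" by (auto simp: D1_iff)
  then show ?thesis
    using NU_rule_functional[OF assms] NU1_dyck_class(2) True by (metis NU_def NU_rule.rotate)
next
  case False
  then have "NU2_rule c d" using assms by (auto simp: NU_rule_iff D1_iff)
  then have "NU2 c = d"
    unfolding NU2_def using NU2_rule_NU_rule NU_rule_functional by (metis the_equality)
  then show ?thesis using False by (simp add: NU_def)
qed

lemma ND_dom_iff: "d \<in> ND_dom \<longleftrightarrow> (\<exists>c. NU_rule c d)"
  unfolding ND_dom_def using NU_dom_iff NU_eq by blast

lemma ND_eq:
  assumes "NU_rule c d" shows "ND d = c"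
proof -
  have "inj_on NU NU_dom"
  proof (rule inj_onI)
    fix x y assume "x \<in> NU_dom" "y \<in> NU_dom" "NU x = NU y"
    then show "x = y" using NU_dom_iff NU_eq NU_rule_injective by metis
  qed
  moreover have "c \<in> NU_dom" using assms NU_dom_iff by blast
  ultimately show ?thesis
    unfolding ND_def NU_eq[OF assms, symmetric] by (rule the_inv_into_f_f)
qed

section \<open>Cycled ternary Dyck vectors under NU and ND\<close>

text \<open>
  \<open>cyc 2\<close> describes the letters of cycled ternary vectors, \<open>cyc 1\<close> those of cycled binary ones.
\<close>

definition cyc :: "int \<Rightarrow> int list \<Rightarrow> bool" where
  "cyc m v \<longleftrightarrow> set v \<subseteq> {-1..m} \<and> sorted_wrt (\<lambda>x y. x = -1 \<longrightarrow> y \<noteq> m) v"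

lemma cyc_Nil [simp]: "cyc m []"
  by (simp add: cyc_def)

lemma cyc_Cons [simp]: "cyc m (x # v) \<longleftrightarrow> -1 \<le> x \<and> x \<le> m \<and> (x = -1 \<longrightarrow> m \<notin> set v) \<and> cyc m v"
  by (auto simp: cyc_def)

lemma cyc_append [simp]: "cyc m (v @ w) \<longleftrightarrow> cyc m v \<and> cyc m w \<and> (-1 \<in> set v \<longrightarrow> m \<notin> set w)"
  by (auto simp: cyc_def sorted_wrt_append)

lemma cyc_replicate: "-1 \<le> x \<Longrightarrow> x \<le> m \<Longrightarrow> 0 \<le> m \<Longrightarrow> cyc m (replicate n x)"
  by (induction n) auto

lemma cyc_nonneg: "set v \<subseteq> {0..m} \<Longrightarrow> cyc m v"
  by (induction v) auto

lemma cyc_no_max: "set v \<subseteq> {-1..<m} \<Longrightarrow> cyc m v"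
  by (induction v) auto

lemma cyc_set: "cyc m v \<Longrightarrow> set v \<subseteq> {-1..m}"
  by (simp add: cyc_def)

lemma cyc_lower: "cyc m v \<Longrightarrow> -1 \<notin> set v \<Longrightarrow> cyc m (lower v)"
proof (induction v)
  case (Cons x v)
  then have "m + 1 \<notin> set v" using cyc_set[of m v] by auto
  then show ?case using Cons by auto
qed simp

lemma cyc_raise: "cyc m v \<Longrightarrow> m \<notin> set v \<Longrightarrow> cyc m (raise v)"
  by (induction v) auto

definition ctdv :: "int list \<Rightarrow> bool" where
  "ctdv v \<longleftrightarrow> is_qdv v \<and> cyc 2 v"

lemma is_tdv_iff: "is_tdv v \<longleftrightarrow> is_qdv v \<and> set v \<subseteq> {0..2}"
proof -
  have "{0..2::int} = {0, 1, 2}" by auto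
  then show ?thesis by (auto simp: is_tdv_def is_dyck_vector_def)
qed

lemma ctdv_if_tdv: "is_tdv v \<Longrightarrow> ctdv v"
  by (simp add: is_tdv_iff ctdv_def cyc_nonneg)

text \<open>Cutting at the first -1 leaves a nonnegative word in front and, since no 2 may follow,
  letters at most 1 behind; the second piece raised by 1 is again a TDV.\<close>

lemma is_cycled_tdv_iff: "is_cycled_tdv v \<longleftrightarrow> ctdv v"
proof
  assume "is_cycled_tdv v"
  then consider "is_tdv v" | A B where "is_qdv v" "is_tdv A" "is_tdv B" "v = A @ lower B"
    by (auto simp: is_cycled_tdv_def)
  then show "ctdv v"
  proof cases
    case 2
    then have "set (lower B) \<subseteq> {-1..<2}" by (auto simp: is_tdv_iff)
    then show ?thesis using 2 by (auto simp: ctdv_def is_tdv_iff cyc_nonneg cyc_no_max)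
  qed (rule ctdv_if_tdv)
next
  assume v: "ctdv v"
  show "is_cycled_tdv v"
  proof (cases "-1 \<in> set v")
    case False
    then have "x \<in> {0..2}" if "x \<in> set v" for x
      using v cyc_set[of 2 v] that by (cases "x = -1") (auto simp: ctdv_def subset_iff)
    then have "is_tdv v" using v by (auto simp: ctdv_def is_tdv_iff)
    then show ?thesis using v by (simp add: is_cycled_tdv_def ctdv_def)
  next
    case True
    then obtain A Q where A: "v = A @ -1 # Q" "-1 \<notin> set A" by (metis split_list_first)
    then have "A \<noteq> []" using v by (auto simp: ctdv_def)
    then have "is_qdv A" using v A by (auto simp: ctdv_def is_qdv_def)
    moreover have "x \<in> {0..2}" if "x \<in> set A" for x
      using v A cyc_set[of 2 A] that by (cases "x = -1") (auto simp: ctdv_def subset_iff)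
    ultimately have "is_tdv A" by (auto simp: is_tdv_iff)
    moreover have "is_tdv (0 # raise Q)"
    proof -
      have "x + 1 \<in> {0..2}" if "x \<in> set Q" for x
        using v A cyc_set[of 2 Q] that by (cases "x = 2") (auto simp: ctdv_def subset_iff)
      then show ?thesis using v A by (auto simp: is_tdv_iff ctdv_def is_qdv_def[of "A @ _"])
    qed
    moreover have "v = A @ lower (0 # raise Q)" using A by simp
    ultimately show ?thesis using v unfolding is_cycled_tdv_def ctdv_def by blast
  qed
qed

text \<open>This and the next two lemmas are \<open>rotate\<close> in shifted representatives. The
  appended letter becomes -1, 1 or 2 instead of 0, so a rotation can be undone at whichever letter
  ends the given word.\<close>

lemma rotate_minus:
  assumes "is_qdv (0 # U @ [-1])"
  shows "NU_rule (dyck_class (0 # 0 # U)) (dyck_class (0 # U @ [-1]))"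
proof -
  have q: "is_qdv (0 # U @ [-1])" "is_qdv (0 # 0 # U)" using assms by (cases "U = []"; simp)+
  have "is_qdv (0 # (1 # raise U) @ [0])" using assms by (cases "U = []") auto
  from NU_rule.rotate[OF this] show ?thesis using dyck_class_up[OF q(1)] dyck_class_up[OF q(2)] by simp
qed

lemma rotate_one:
  assumes "is_qdv (0 # 1 # Z @ [1])"
  shows "NU_rule (dyck_class (0 # 1 # 2 # Z)) (dyck_class (0 # 1 # Z @ [1]))"
proof -
  have q: "is_qdv (0 # lower Z @ [0])" "is_qdv (0 # 1 # lower Z)" using assms by (auto simp: hd_append)
  have "NU_rule (dyck_class (up (0 # 1 # lower Z))) (dyck_class (up (0 # lower Z @ [0])))"
    using NU_rule.rotate[of "lower Z"] q by (simp only: dyck_class_up)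
  then show ?thesis by simp
qed

lemma rotate_two:
  assumes "is_qdv (0 # 1 # 2 # Z @ [2])"
  shows "NU_rule (dyck_class (0 # 1 # 2 # lower Z)) (dyck_class (0 # 1 # 2 # Z @ [2]))"
proof -
  have q: "is_qdv (0 # 1 # lower Z @ [1])" using assms by (auto simp: hd_append)
  show ?thesis using rotate_one[OF q] dyck_class_up[OF q] by simp
qed

section \<open>Predecessors of cycled ternary classes\<close>

definition initial :: "int list \<Rightarrow> bool" where
  "initial v \<longleftrightarrow> is_tdv v \<and> (type1 v \<or> type2 v \<or> type3 v)"

lemma split_lead:
  obtains n Z where "v = replicate n x @ Z" "Z = [] \<or> hd Z \<noteq> x"
proof -
  have "\<exists>n Z. v = replicate n x @ Z \<and> (Z = [] \<or> hd Z \<noteq> x)"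
  proof (induction v)
    case (Cons y v)
    then obtain n Z where *: "v = replicate n x @ Z" "Z = [] \<or> hd Z \<noteq> x" by blast
    show ?case
    proof (cases "y = x")
      case True
      then have "y # v = replicate (Suc n) x @ Z" using * by simp
      then show ?thesis using * by blast
    next
      case False
      then have "y # v = replicate 0 x @ (y # v)" "hd (y # v) \<noteq> x" by simp_all
      then show ?thesis by blast
    qed
  qed simp
  then show ?thesis using that by blast
qed

lemma split_trail:
  obtains n Z where "v = Z @ replicate n x" "Z = [] \<or> last Z \<noteq> x"
proof -
  obtain n Z where "rev v = replicate n x @ Z" "Z = [] \<or> hd Z \<noteq> x" by (rule split_lead)
  then have "v = rev Z @ replicate n x" "rev Z = [] \<or> last (rev Z) \<noteq> x"
    by (metis rev_append rev_replicate rev_rev_ident) (auto simp: last_rev \<open>Z = [] \<or> hd Z \<noteq> x\<close>)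
  then show ?thesis using that by blast
qed

definition has_pred :: "int list \<Rightarrow> bool" where
  "has_pred v \<longleftrightarrow> (\<exists>u. ctdv u \<and> NU_rule (dyck_class u) (dyck_class v)) \<or>
     (\<exists>t. initial t \<and> dyck_class v = dyck_class t)"

lemma has_predI: "ctdv u \<Longrightarrow> NU_rule (dyck_class u) (dyck_class v) \<Longrightarrow> has_pred v"
  by (auto simp: has_pred_def)

lemma ctdv_src_a: "ok_a h A \<Longrightarrow> cyc 2 A \<Longrightarrow> ctdv (src_a h A)"
  by (simp add: ctdv_def is_qdv_src_a) (auto simp: src_a_def cyc_replicate)

lemma ctdv_src_b: "ok_b k B \<Longrightarrow> cyc 2 B \<Longrightarrow> ctdv (src_b k B)"
  by (simp add: ctdv_def is_qdv_src_b) (auto simp: src_b_def cyc_replicate)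

lemma has_pred_a:
  assumes "ok_a h A" "cyc 2 A" "v = tgt_a h A \<or> v = up (tgt_a h A)" shows "has_pred v"
  using assms by (auto intro!: has_predI[OF ctdv_src_a] NU_rule.rule_a simp: is_qdv_tgt_a)

lemma has_pred_b:
  assumes "ok_b k B" "cyc 2 B" "v = tgt_b k B \<or> v = up (tgt_b k B)" shows "has_pred v"
  using assms by (auto intro!: has_predI[OF ctdv_src_b] NU_rule.rule_b simp: is_qdv_tgt_b)

lemma has_pred_zero:
  assumes "ctdv v" "v = 0 # U @ [0]" shows "has_pred v"
proof (rule has_predI[of "0 # 1 # U"])
  show "ctdv (0 # 1 # U)" using assms by (auto simp: ctdv_def hd_append split: if_splits)
  show "NU_rule (dyck_class (0 # 1 # U)) (dyck_class v)"
    using assms by (auto simp: ctdv_def simp del: is_qdv_Cons intro: NU_rule.rotate)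
qed

lemma has_pred_minus:
  assumes "ctdv v" "v = 0 # U @ [-1]" shows "has_pred v"
proof (rule has_predI[of "0 # 0 # U"])
  show "ctdv (0 # 0 # U)" using assms by (auto simp: ctdv_def hd_append split: if_splits)
  show "NU_rule (dyck_class (0 # 0 # U)) (dyck_class v)"
    using assms by (auto simp: ctdv_def simp del: is_qdv_Cons intro: rotate_minus)
qed

lemma has_pred_one:
  assumes "ctdv v" "v = 0 # 1 # Z @ [1]" shows "has_pred v"
proof (rule has_predI[of "0 # 1 # 2 # Z"])
  show "ctdv (0 # 1 # 2 # Z)" using assms by (auto simp: ctdv_def hd_append split: if_splits)
  show "NU_rule (dyck_class (0 # 1 # 2 # Z)) (dyck_class v)"
    using assms by (auto simp: ctdv_def simp del: is_qdv_Cons intro: rotate_one)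
qed

lemma has_pred_two:
  assumes "ctdv v" "v = 0 # 1 # 2 # Z @ [2]" shows "has_pred v"
proof (rule has_predI[of "0 # 1 # 2 # lower Z"])
  show "ctdv (0 # 1 # 2 # lower Z)" using assms by (auto simp: ctdv_def hd_append cyc_lower split: if_splits)
  show "NU_rule (dyck_class (0 # 1 # 2 # lower Z)) (dyck_class v)"
    using assms by (auto simp: ctdv_def simp del: is_qdv_Cons intro: rotate_two)
qed

lemma cyc_in_set: "cyc m v \<Longrightarrow> x \<in> set v \<Longrightarrow> -1 \<le> x \<and> x \<le> m"
  using cyc_set by force

lemma has_pred_initial: "initial t \<Longrightarrow> v = t \<or> v = up t \<Longrightarrow> has_pred v"
  by (auto simp: has_pred_def initial_def is_tdv_iff)

text \<open>Without its first letter and lowered by 1, \<open>v\<close> reads 0^m W^- 0 1^n. As m >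
  n this is a target of (b) with k = n; the m - n - 1 surplus zeros are put in front of
  \<open>B\<close>.\<close>

lemma has_pred_last_two_b:
  assumes v: "v = 0 # replicate m 1 @ W @ 1 # replicate n 2" "ctdv v" "-1 \<notin> set v"
    and n: "n \<ge> 1" and W: "W = [] \<or> hd W \<noteq> 1" and m: "n < m"
  shows "has_pred v"
proof -
  obtain d where d: "m = Suc n + d" using m less_imp_Suc_add by auto
  define B where "B = replicate d 0 @ lower W"
  have W': "cyc 2 W" "-1 \<notin> set W" "slow_rise W" "W \<noteq> [] \<Longrightarrow> hd W \<le> 2" "W \<noteq> [] \<Longrightarrow> last W \<ge> 0"
    using v m by (auto simp: ctdv_def hd_append split: if_splits)
  have "x - 1 \<le> 2" if "x \<in> set W" for x
    using cyc_in_set[OF W'(1) that] by simp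
  then have "ok_b n B"
    using W' n by (cases "W = []"; cases "d = 0") (auto simp: ok_b_def B_def hd_append)
  moreover have "cyc 2 B" using W' by (auto simp: B_def cyc_lower cyc_replicate)
  moreover have "v = up (tgt_b n B)"
    using v by (simp add: tgt_b_def B_def d replicate_add)
  ultimately show ?thesis by (intro has_pred_b) auto
qed

text \<open>No -1 can precede the final 2, so \<open>v\<close> is 0 1^m W 1 2^n with maximal runs.
  It is a shift of a word with 0^m (or 0^(m+1) if \<open>W\<close> is empty) in front and 1^n at the
  end, and the comparison of m with n decides between (b), (a) and Types 1 and 3.\<close>

lemma has_pred_last_two:
  assumes v: "ctdv v" "last v = 2"
  shows "has_pred v"
proof -
  obtain n V where V: "v = V @ replicate n 2" "V = [] \<or> last V \<noteq> 2" by (rule split_trail)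
  then have n: "n \<ge> 1" using v by (cases n) (auto simp: ctdv_def)
  have nonneg: "-1 \<notin> set v"
  proof
    assume "-1 \<in> set v"
    then have "-1 \<in> set V" using V by auto
    then show False using v V n by (auto simp: ctdv_def)
  qed
  have "V \<noteq> []" using v V n by (cases n) (auto simp: ctdv_def)
  then have "last V = 1"
    using v V n nonneg cyc_in_set[of 2 v "last V"] by (cases n) (auto simp: ctdv_def is_qdv_def)
  then obtain V' where V': "V = 0 # V' @ [1]"
    using \<open>V \<noteq> []\<close> v V by (cases V; cases "tl V" rule: rev_cases) (auto simp: ctdv_def)
  obtain m W where mW: "V' = replicate m 1 @ W" "W = [] \<or> hd W \<noteq> 1" by (rule split_lead)
  have v': "v = 0 # replicate m 1 @ W @ 1 # replicate n 2" using V V' mW by simp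
  have W: "cyc 2 W" "-1 \<notin> set W" "slow_rise W" "W \<noteq> [] \<Longrightarrow> hd W \<le> 2" "W \<noteq> [] \<Longrightarrow> last W \<ge> 0"
    "W \<noteq> [] \<Longrightarrow> m = 0 \<Longrightarrow> hd W \<le> 1"
    using v nonneg unfolding v' by (auto simp: ctdv_def hd_append split: if_splits)
  have tdv: "is_tdv v"
  proof -
    have "x \<in> {0..2}" if "x \<in> set v" for x
      using that v nonneg cyc_in_set[of 2 v x] by (cases "x = -1") (auto simp: ctdv_def)
    then show ?thesis using v by (auto simp: is_tdv_iff ctdv_def)
  qed
  have "W = [] \<or> hd W = 0 \<or> hd W = 2"
    using mW(2) W(2) cyc_in_set[OF W(1), of "hd W"] by (cases W) auto
  moreover have "m \<ge> 1" if "W \<noteq> []" "hd W = 2"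
    using W(6)[OF that(1)] that(2) by (cases m) auto
  ultimately consider "n < m" | "m \<le> n" "W \<noteq> []" "hd W = 0" | "m \<le> n" "W = []"
    | "m \<le> n" "W \<noteq> []" "hd W = 2" "m \<ge> 1"
    using not_le by blast
  then show ?thesis
  proof cases
    case 1
    then show ?thesis using has_pred_last_two_b[OF v' v(1) nonneg n mW(2)] by blast
  next
    case 2
    then obtain X where "W = 0 # X" by (cases W) auto
    then have "v = [0] @ replicate m 1 @ [0] @ (X @ [1]) @ replicate n 2" "last (X @ [1]) \<noteq> (2::int)"
      using v' by simp_all
    then have "type1 v" unfolding type1_def using 2 n by blast
    then show ?thesis using has_pred_initial[of v v] tdv by (simp add: initial_def)
  next
    case 3
    \<comment> \<open>Here \<open>v\<close> is the shift of 0^(m+1) 1^n. Type 3 is n = m or n = m +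
      1; a larger n belongs to rule (a) with h = m + 1. Since h must be at least 2, m = 0 is treated
      separately.\<close>
    consider "m = 0" "n = 1" | "m = 0" "n \<ge> 2" | "m = n" | "m = n - 1" "n \<ge> 2" | "m \<ge> 1" "m + 2 \<le> n"
      using 3 n by linarith
    then show ?thesis
    proof cases
      case 1
      then have "v = up (up [0])" using v' 3 by simp
      then have "dyck_class v = dyck_class [0]" by (simp only:) (simp del: up_Cons add: is_qdv_up)
      moreover have "initial [0]" by (simp add: initial_def type3_def is_tdv_iff)
      ultimately show ?thesis by (auto simp: has_pred_def)
    next
      case 2
      then obtain d where "n = Suc (Suc d)" using less_imp_Suc_add[of 1 n] by auto
      then have "v = 0 # 1 # 2 # replicate d 2 @ [2]" using v' 3 2 by (simp add: replicate_append_same)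
      then show ?thesis by (rule has_pred_two[OF v(1)])
    next
      case 3
      then have eq: "v = up (replicate (Suc n) 0 @ replicate n 1)"
        using v' \<open>W = []\<close> by (simp add: replicate_app_Cons_same)
      moreover have "initial (replicate (Suc n) 0 @ replicate n 1)"
      proof -
        have "type3 (replicate (Suc n) 0 @ replicate n 1)"
          unfolding type3_def using n by (intro disjI1 exI[of _ "Suc n"]) auto
        then show ?thesis by (auto simp: initial_def is_tdv_iff hd_append hd_replicate last_replicate)
      qed
      ultimately show ?thesis using has_pred_initial by blast
    next
      case 4
      then have eq: "v = up (replicate n 0 @ replicate n 1)"
        using v' \<open>W = []\<close> by (cases n) (auto simp add: replicate_app_Cons_same)
      moreover have "initial (replicate n 0 @ replicate n 1)"
      proof -
        have "type3 (replicate n 0 @ replicate n 1)"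
          unfolding type3_def using 4 by (intro disjI1 exI[of _ "n"]) auto
        then show ?thesis using n
          by (cases n) (auto simp: initial_def is_tdv_iff hd_append hd_replicate last_replicate)
      qed
      ultimately show ?thesis using has_pred_initial by blast
    next
      case 5
      then obtain d where d: "n = Suc (Suc (d + m))" using less_imp_Suc_add[of "Suc m" n] by (auto simp: add.commute)
      have "ok_a (Suc m) (replicate d 1)" using 5 by (simp add: ok_a_def)
      moreover have "v = up (tgt_a (Suc m) (replicate d 1))"
        using v' 3 d by (simp add: tgt_a_def replicate_add replicate_app_Cons_same)
      ultimately show ?thesis by (intro has_pred_a) (auto simp: cyc_replicate)
    qed
  next
    case 4
    then obtain X where X: "W = 2 # X" by (cases W) auto
    \<comment> \<open>Rule (a) with h = m needs m at least 2. For m = 1 the word begins with 012 and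
      ends in 2, so a rotation can be undone instead.\<close>
    show ?thesis
    proof (cases "m = 1")
      case True
      obtain d where "n = Suc d" using n by (cases n) auto
      then have "v = 0 # 1 # 2 # (X @ 1 # replicate d 2) @ [2]"
        using v' X True by (simp add: replicate_append_same)
      then show ?thesis by (rule has_pred_two[OF v(1)])
    next
      case False
      obtain d where d: "n = d + m" using 4 by (metis le_Suc_ex add.commute)
      \<comment> \<open>Of the n ones at the end of the lowered word, m form the final block of the
        target of (a); the other d belong to \<open>A\<close>.\<close>
      define A where "A = lower X @ 0 # replicate d 1"
      have "x \<le> 3" if "x \<in> set X" for x
        using cyc_in_set[OF W(1), of x] that by (simp add: X)
      then have "ok_a m A"
        using False 4 W unfolding ok_a_def A_def X
        by (cases "X = []") (auto simp: hd_append split: if_splits)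
      moreover have "cyc 2 A" using W unfolding A_def X by (auto simp: cyc_lower cyc_replicate)
      moreover have "v = up (tgt_a m A)"
        using v' 4 d unfolding A_def X
        by (cases m) (simp_all add: tgt_a_def replicate_add replicate_app_Cons_same)
      ultimately show ?thesis by (intro has_pred_a) auto
    qed
  qed
qed

text \<open>The word is 0^n 1 Y e 1^m with maximal outer runs. For n = 1 a rotation is undone, for 2
  <= n <= m rule (a) with h = n. For n > m the letter e decides: e = 0 fits rule (b) with k = m, and
  e = 2 is Type 2.\<close>

lemma has_pred_last_one:
  assumes v: "ctdv v" "last v = 1" "2 \<in> set v"
  shows "has_pred v"
proof -
  obtain m V where V: "v = V @ replicate m 1" "V = [] \<or> last V \<noteq> 1" by (rule split_trail)
  have "V \<noteq> []" using v V by (auto simp: ctdv_def)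
  then have m: "m \<ge> 1" using v V by (cases m) auto
  obtain n Z where Z: "V = replicate n 0 @ Z" "Z = [] \<or> hd Z \<noteq> 0" by (rule split_lead)
  have "Z \<noteq> []" "2 \<in> set Z" using v V Z by auto
  have hd0: "hd V = 0" using v V \<open>V \<noteq> []\<close> by (auto simp: ctdv_def is_qdv_def)
  then have n: "n \<ge> 1" using Z \<open>Z \<noteq> []\<close> by (cases n) auto
  have sr: "slow_rise v" and cyc: "cyc 2 v" using v by (auto simp: ctdv_def is_qdv_def)
  \<comment> \<open>A -1 here would precede the 2 in \<open>Z\<close>.\<close>
  have "hd Z \<noteq> -1" using cyc V Z \<open>2 \<in> set Z\<close> by (cases Z) auto
  moreover have "hd Z \<le> 1" using sr V Z \<open>Z \<noteq> []\<close> n by (auto simp: hd_append last_append)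
  moreover have "hd Z \<ge> -1" using cyc V Z \<open>Z \<noteq> []\<close> by (cases Z) auto
  ultimately have "hd Z = 1" using Z \<open>Z \<noteq> []\<close> by auto
  then obtain Z1 where Z1: "Z = 1 # Z1" using \<open>Z \<noteq> []\<close> by (cases Z) auto
  then obtain Y e where Y: "Z1 = Y @ [e]" using \<open>2 \<in> set Z\<close> by (cases Z1 rule: rev_cases) auto
  have v': "v = replicate n 0 @ 1 # (Y @ [e]) @ replicate m 1" using V Z Z1 Y by simp
  \<comment> \<open>The run of final ones is maximal, and a 1 may follow \<open>e\<close> only if
    \<open>e\<close> is at least 0.\<close>
  have e: "e = 0 \<or> e = 2"
  proof -
    have "e \<noteq> 1" using V Z Z1 Y by auto
    moreover have "0 \<le> e" "e \<le> 2" using sr cyc m unfolding v' by (cases m; auto)+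
    ultimately show ?thesis by auto
  qed
  consider "n = 1" | "n \<ge> 2" "n \<le> m" | "n \<ge> 2" "m < n" using n by linarith
  then show ?thesis
  proof cases
    case 1
    obtain j where "m = Suc j" using m by (cases m) auto
    then have "v = 0 # 1 # (Y @ e # replicate j 1) @ [1]" using v' 1 by (simp add: replicate_append_same)
    then show ?thesis by (rule has_pred_one[OF v(1)])
  next
    case 2
    then obtain d where d: "m = d + n" by (metis le_Suc_ex add.commute)
    define A where "A = Y @ [e] @ replicate d 1"
    have "ok_a n A" using 2 sr e cyc_in_set[of 2 "Y"] cyc unfolding v' A_def ok_a_def
      by (cases "Y = []") (auto simp: hd_append last_append hd_replicate)
    moreover have "cyc 2 A" using cyc unfolding v' A_def by (auto simp: cyc_replicate)
    moreover have "v = tgt_a n A" unfolding v' A_def tgt_a_def d by (simp add: replicate_add)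
    ultimately show ?thesis by (intro has_pred_a) auto
  next
    case 3
    show ?thesis
    proof (cases "e = 2")
      case True
      then have "v = replicate n 0 @ (1 # Y) @ [2] @ replicate m 1" using v' by simp
      then have "type2 v" unfolding type2_def using 3 m
        by (intro exI[of _ m] exI[of _ n] exI[of _ "1 # Y"]) auto
      moreover have "x \<in> {0..2}" if "x \<in> set v" for x
        using that True cyc cyc_in_set[OF cyc that] m unfolding v' by (cases "x = -1") auto
      then have "is_tdv v" using v by (auto simp: is_tdv_iff ctdv_def)
      ultimately show ?thesis using has_pred_initial[of v v] by (simp add: initial_def)
    next
      case False
      obtain d where d: "n = Suc m + d" using 3 less_imp_Suc_add by auto
      define B where "B = replicate d 0 @ 1 # Y"
      have "ok_b m B" using 3 m sr False e cyc_in_set[of 2 "Y"] cyc unfolding v' B_def ok_b_def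
        by (cases "Y = []") (auto simp: hd_append last_append hd_replicate)
      moreover have "cyc 2 B" using cyc unfolding v' B_def by (auto simp: cyc_replicate)
      moreover have "v = tgt_b m B" using False e unfolding v' B_def tgt_b_def d by (simp add: replicate_add)
      ultimately show ?thesis by (intro has_pred_b) auto
    qed
  qed
qed

lemma has_pred_ctdv:
  assumes v: "ctdv v" shows "has_pred v"
proof -
  have "v \<noteq> []" using v by (auto simp: ctdv_def)
  then have "last v \<in> {-1..2}" using v cyc_in_set[of 2 v "last v"] by (auto simp: ctdv_def)
  then consider "last v = -1" | "last v = 0" | "last v = 1" "2 \<in> set v" | "last v = 1" "2 \<notin> set v" | "last v = 2"
    by force
  then show ?thesis
  proof cases
    case 1
    then obtain U where "v = 0 # U @ [-1]"
      using v by (cases v; cases "tl v" rule: rev_cases) (auto simp: ctdv_def)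
    then show ?thesis by (rule has_pred_minus[OF v])
  next
    case 2
    show ?thesis
    proof (cases "tl v" rule: rev_cases)
      case Nil
      then have "v = [0]" using v by (cases v) (auto simp: ctdv_def)
      moreover have "initial [0]" by (simp add: initial_def type3_def is_tdv_iff)
      ultimately show ?thesis using has_pred_initial by blast
    next
      case (snoc U x)
      then have "v = 0 # U @ [0]" using v 2 by (cases v) (auto simp: ctdv_def)
      then show ?thesis by (rule has_pred_zero[OF v])
    qed
  next
    case 3
    then show ?thesis using has_pred_last_one v by blast
  next
    case 4
    \<comment> \<open>Without a 2 the word can be shifted once and stays cycled ternary; the shift
      ends in 2.\<close>
    have "ctdv (up v)"
      using v 4 by (auto simp: ctdv_def is_qdv_up) (auto simp: up_def cyc_raise)
    moreover have "last (up v) = 2" using 4 \<open>v \<noteq> []\<close> by (simp add: up_def)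
    ultimately have "has_pred (up v)" by (rule has_pred_last_two)
    then show ?thesis using v by (simp add: has_pred_def ctdv_def)
  next
    case 5
    then show ?thesis using has_pred_last_two v by blast
  qed
qed

section \<open>Successors of cycled ternary classes\<close>

lemma ctdv_tgt_a: "ok_a h A \<Longrightarrow> cyc 2 A \<Longrightarrow> ctdv (tgt_a h A)"
  by (simp add: ctdv_def is_qdv_tgt_a) (auto simp: tgt_a_def cyc_replicate)

lemma ctdv_tgt_b: "ok_b k B \<Longrightarrow> cyc 2 B \<Longrightarrow> ctdv (tgt_b k B)"
  by (simp add: ctdv_def is_qdv_tgt_b) (auto simp: tgt_b_def cyc_replicate)

text \<open>Write the word as 01 2^h A (-1)^k with maximal runs. If h <= k, rule (b) applies and the
  surplus -1's join its free word; if h > k, rule (a) applies with parameter k + 1 and the surplus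
  twos join its free word.\<close>

lemma ctdv_succ_minus:
  assumes v: "ctdv (0 # 1 # 2 # Z)" and Z: "Z \<noteq> []" "last Z = -1"
  shows "\<exists>u. ctdv u \<and> NU_rule (dyck_class (0 # 1 # 2 # Z)) (dyck_class u)"
proof -
  obtain h Y where h: "2 # Z = replicate h 2 @ Y" "Y = [] \<or> hd Y \<noteq> 2" by (rule split_lead)
  have "Y \<noteq> []"
  proof
    assume "Y = []"
    then have "last (2 # Z) = 2" using h by (cases h) auto
    then show False using Z by auto
  qed
  obtain k A where k: "Y = A @ replicate k (-1)" "A = [] \<or> last A \<noteq> -1" by (rule split_trail)
  have h1: "h \<ge> 1" using h by (cases h) auto
  have "last Y = -1" using Z h(1) \<open>Y \<noteq> []\<close> by (metis last_ConsR last_append)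
  then have k1: "k \<ge> 1" using k \<open>Y \<noteq> []\<close> by (cases k) auto
  have v': "0 # 1 # 2 # Z = [0, 1] @ replicate h 2 @ A @ replicate k (-1)" using h k by simp
  have sr: "slow_rise (replicate h 2 @ A @ replicate k (-1))" and cyc: "cyc 2 A"
    using v unfolding v' by (auto simp: ctdv_def)
  have A: "x \<le> 2" "-1 \<le> x" if "x \<in> set A" for x using cyc_in_set[OF cyc that] by auto
  have A': "A \<noteq> [] \<longrightarrow> last A \<ge> 0 \<and> hd A \<le> 1 \<and> slow_rise A"
  proof
    assume ne: "A \<noteq> []"
    then have "last A \<noteq> -1" "hd A \<noteq> 2" using h k by auto
    moreover have "-1 \<le> last A" "hd A \<le> 2" using A ne by auto
    ultimately show "last A \<ge> 0 \<and> hd A \<le> 1 \<and> slow_rise A" using sr by auto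
  qed
  show ?thesis
  proof (cases "h \<le> k")
    case True
    then obtain d where d: "k = d + h" by (metis le_Suc_ex add.commute)
    let ?B = "A @ replicate d (-1)"
    have "ok_b h ?B" using h1 A A' by (auto simp: ok_b_def hd_append hd_replicate last_append)
    moreover have "cyc 2 ?B" using cyc by (auto simp: cyc_replicate)
    moreover have "0 # 1 # 2 # Z = src_b h ?B" unfolding v' d by (simp add: src_b_def replicate_add)
    ultimately show ?thesis using NU_rule.rule_b ctdv_tgt_b by metis
  next
    case False
    then obtain d where d: "h = Suc k + d" using less_imp_Suc_add by (metis not_le add_Suc)
    let ?A = "replicate d 2 @ A"
    have "ok_a (Suc k) ?A" using k1 A A' by (auto simp: ok_a_def last_append)
    moreover have "cyc 2 ?A" using cyc by (auto simp: cyc_replicate)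
    moreover have "0 # 1 # 2 # Z = src_a (Suc k) ?A" unfolding v' d by (simp add: src_a_def replicate_add)
    ultimately show ?thesis using NU_rule.rule_a ctdv_tgt_a by metis
  qed
qed

text \<open>The first letters tell in which representative to rotate, hence which letter to append.
  The only obstruction is a word 012Z ending in -1, where the letter 1 would rise too steeply; there
  rules (a) and (b) take over.\<close>

lemma ctdv_succ:
  assumes v: "ctdv v" shows "\<exists>u. ctdv u \<and> NU_rule (dyck_class v) (dyck_class u)"
proof -
  obtain V where V: "v = 0 # V" using v by (auto simp: ctdv_def elim: is_qdvE)
  show ?thesis
  proof (cases V)
    case Nil
    have "NU_rule (dyck_class [0]) (dyck_class [0, 0])"
      using NU_rule.rotate[of "[]"] dyck_class_up[of "[0]"] by simp
    moreover have "ctdv [0, 0]" by (simp add: ctdv_def)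
    ultimately show ?thesis using V Nil by blast
  next
    case (Cons y W)
    have "-1 \<le> y" "y \<le> 1" using v V Cons by (auto simp: ctdv_def)
    then consider "y = -1" | "y = 0" | "y = 1" "W = [] \<or> hd W \<le> 1" | "y = 1" "W \<noteq> []" "hd W > 1" by force
    then show ?thesis
    proof cases
      case 1
      have "is_qdv (0 # (0 # raise W) @ [0])" "ctdv (0 # (0 # raise W) @ [0])"
        using v V Cons 1 cyc_in_set[of 2 W "last W"]
        by (cases "W = []"; auto simp: ctdv_def cyc_raise)+
      moreover have "dyck_class v = dyck_class (0 # 1 # 0 # raise W)"
        using dyck_class_up[of v] v V Cons 1 by (simp add: ctdv_def)
      ultimately show ?thesis using NU_rule.rotate by metis
    next
      case 2
      have "is_qdv (0 # W @ [-1])" "ctdv (0 # W @ [-1])"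
        using v V Cons 2 cyc_in_set[of 2 W "last W"]
        by (cases "W = []"; auto simp: ctdv_def)+
      then show ?thesis using rotate_minus V Cons 2 by metis
    next
      case 3
      have "is_qdv (0 # W @ [0])" "ctdv (0 # W @ [0])"
        using v V Cons 3 cyc_in_set[of 2 W "last W"]
        by (cases "W = []"; auto simp: ctdv_def)+
      then show ?thesis using NU_rule.rotate V Cons 3 by metis
    next
      case 4
      then obtain Z where Z: "W = 2 # Z" using v V Cons by (cases W) (auto simp: ctdv_def)
      show ?thesis
      proof (cases "Z \<noteq> [] \<and> last Z = -1")
        case True
        then show ?thesis using ctdv_succ_minus v V Cons 4 Z by metis
      next
        case False
        then have "is_qdv (0 # 1 # Z @ [1])" "ctdv (0 # 1 # Z @ [1])"
          using v V Cons 4 Z cyc_in_set[of 2 Z "last Z"] cyc_in_set[of 2 Z "hd Z"]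
          by (cases "Z = []"; auto simp: ctdv_def)+
        then show ?thesis using rotate_one V Cons 4 Z by metis
      qed
    qed
  qed
qed

section \<open>Classes of Types 1, 2 and 3 have no predecessor\<close>

lemma lead_raise: "lead (x + 1) (raise v) = lead x v"
  by (induction v) auto

lemma trail_raise: "trail (x + 1) (raise v) = trail x v"
  using lead_raise[of x "rev v"] by (simp add: trail_def raise_def rev_map)

lemma up_funpow_ge_2: "is_qdv x \<Longrightarrow> v = (up ^^ k) x \<Longrightarrow> k \<ge> 2 \<Longrightarrow> \<exists>W. v = 0 # 1 # 2 # W"
proof -
  assume *: "is_qdv x" "v = (up ^^ k) x" "k \<ge> 2"
  then obtain j where "k = Suc (Suc j)" using less_imp_Suc_add[of 1 k] by auto
  moreover have "is_qdv ((up ^^ j) x)" using * by (simp add: is_qdv_up_funpow)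
  ultimately show ?thesis using *(2) by (auto elim!: is_qdvE)
qed

lemma NU_rule_tgtE:
  assumes "NU_rule c (dyck_class t)"
  obtains U where "is_qdv (0 # U @ [0])" "dyck_class t = dyck_class (0 # U @ [0])"
    | h A where "ok_a h A" "dyck_class t = dyck_class (tgt_a h A)"
    | k B where "ok_b k B" "dyck_class t = dyck_class (tgt_b k B)"
  using assms by (auto elim!: NU_rule.cases)

text \<open>A target of a rule in this class would be \<open>t\<close> shifted down once. The final
  2 excludes a rotation. Rule (a) would need a 2 after the run 1^m, where \<open>t\<close> has 0;
  rule (b) would need m > n.\<close>

lemma type1_no_pred:
  assumes t: "is_qdv t" "type1 t" shows "\<not> NU_rule c (dyck_class t)"
proof
  obtain m n X where n: "n \<ge> 1" "m \<le> n" "\<not> (X \<noteq> [] \<and> last X = 2)"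
    and t': "t = 0 # replicate m 1 @ 0 # X @ replicate n 2"
    using t by (auto simp: type1_def)
  have lt: "last t = 2" using n by (simp add: t')
  have not012: "t \<noteq> 0 # 1 # 2 # W" for W
    by (cases m; cases "m - 1") (auto simp: t')
  have no: "x = (up ^^ k) t \<Longrightarrow> last x \<ge> 2" for x k using last_up_funpow[of t k] lt t' by auto
  \<comment> \<open>The last letter 2 forces at least one shift from \<open>x\<close> to
    \<open>t\<close>; two shifts would make \<open>t\<close> begin with 012.\<close>
  have up: "t = up x" if x: "is_qdv x" "dyck_class t = dyck_class x" "last x \<le> 1" for x
    using x(2)
  proof (rule dyck_class_eqE)
    fix k assume "x = (up ^^ k) t" then show ?thesis using no x by force
  next
    fix k assume k: "t = (up ^^ k) x"
    then have "k < 2" using up_funpow_ge_2[OF x(1) k] not012 by (meson not_le)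
    moreover have "x \<noteq> []" using x by auto
    ultimately show ?thesis using k last_up_funpow[of x k] lt x(3) by (cases k) auto
  qed
  have lead: "lead 1 (tl t) = m" by (simp add: t')
  have trail: "trail 2 (tl t) = n"
    using n by (cases "X = []") (auto simp: t' trail_def hd_rev)
  assume "NU_rule c (dyck_class t)"
  then show False
  proof (cases rule: NU_rule_tgtE)
    case (1 U)
    then have "t = up (0 # U @ [0])" by (intro up) auto
    then show False using lt by simp
  next
    case (2 h A)
    then have eq: "t = up (tgt_a h A)" by (intro up) (auto simp: is_qdv_tgt_a last_rules)
    have "lead 0 (tgt_a h A) = m" using lead lead_raise[of 0 "tgt_a h A"] by (simp add: eq up_def)
    then have "h = m" by (simp add: lead_tgt_a)
    then show False using eq by (simp add: t' up_def tgt_a_def)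
  next
    case (3 k B)
    then have eq: "t = up (tgt_b k B)" by (intro up) (auto simp: is_qdv_tgt_b last_rules)
    have "lead 0 (tgt_b k B) = m" using lead lead_raise[of 0 "tgt_b k B"] by (simp add: eq up_def)
    moreover have "trail 1 (tgt_b k B) = n" using trail trail_raise[of 1 "tgt_b k B"] by (simp add: eq up_def)
    ultimately show False using lead_tgt_b[of k B] trail_tgt_b[of k B] n by simp
  qed
qed

text \<open>All representatives of this class are shifts of \<open>t\<close> and end in at least 1,
  which excludes a rotation; for (a) and (b) the last letters agree, so the lists do.\<close>

lemma reduced_last_one_pred:
  assumes t: "reduced t" "last t = 1" and "NU_rule c (dyck_class t)"
  obtains h A where "ok_a h A" "t = tgt_a h A" | k B where "ok_b k B" "t = tgt_b k B"
  using assms(3)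
proof (cases rule: NU_rule_tgtE)
  case (1 U)
  have tne: "t \<noteq> []" using t by (auto simp: reduced_def)
  obtain k where "0 # U @ [0] = (up ^^ k) t"
    using dyck_class_eq_reduced[OF 1(2) t(1) 1(1)] by blast
  then have "last (0 # U @ [0]) = 1 + int k" using last_up_funpow[OF tne, of k] t by simp
  then show ?thesis by simp
next
  case (2 h A)
  then have "t = tgt_a h A" using t by (intro dyck_class_eq_last) (auto simp: last_rules reduced_def)
  then show ?thesis using 2 that by blast
next
  case (3 k B)
  then have "t = tgt_b k B" using t by (intro dyck_class_eq_last) (auto simp: last_rules reduced_def)
  then show ?thesis using 3 that by blast
qed

text \<open>Rule (a) would force h = n and hence at least n final ones, but there are only m < n.
  Rule (b) would force a 0 where \<open>t\<close> has its 2 before the final ones.\<close>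

lemma type2_no_pred:
  assumes t: "is_qdv t" "type2 t" shows "\<not> NU_rule c (dyck_class t)"
proof
  obtain m n Y where n: "n \<ge> 2" "0 < m" "m < n" "\<not> (Y \<noteq> [] \<and> hd Y = 0)"
    and t': "t = replicate n 0 @ Y @ 2 # replicate m 1"
    using t by (auto simp: type2_def)
  have "hd (tl t) = 0" using n unfolding t' by (cases n; cases "n - 1") auto
  then have "reduced t" using t by (simp add: reduced_def)
  moreover have "last t = 1" using n by (simp add: t')
  moreover assume "NU_rule c (dyck_class t)"
  ultimately show False
  proof (cases rule: reduced_last_one_pred)
    case (1 h A)
    have "lead 0 t = n" using n by (cases "Y = []") (auto simp: t')
    then have "h = n" using 1 by (simp add: lead_tgt_a)
    moreover have "trail 1 t = m" by (simp add: t' trail_def)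
    ultimately show False using trail_tgt_a[of h A] 1 n by simp
  next
    case (2 k B)
    have "trail 1 t = m" by (simp add: t' trail_def)
    then have "k = m" using 2 trail_tgt_b by metis
    have "(replicate n 0 @ Y @ [2]) @ replicate m 1 = ((replicate (Suc k) 0 @ B) @ [0]) @ replicate k 1"
      using 2 by (simp add: t' tgt_b_def)
    then have "replicate n 0 @ Y @ [2] = (replicate (Suc k) 0 @ B) @ [0]"
      unfolding \<open>k = m\<close> append_same_eq by simp
    then have "last (replicate n 0 @ Y @ [2]) = last ((replicate (Suc k) 0 @ B) @ [0])" by metis
    then show False by simp
  qed
qed

text \<open>The runs fix the parameter of the rule, and then \<open>t\<close> is too short: a target
  of (a) has length at least 2h + 1, a target of (b) at least 2k + 2. For \<open>[0]\<close>, the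
  representatives 0, 01, 012, ... match no target.\<close>

lemma type3_no_pred:
  assumes t: "is_qdv t" "type3 t" shows "\<not> NU_rule c (dyck_class t)"
proof
  assume N: "NU_rule c (dyck_class t)"
  consider n m where "n \<ge> 2" "m = n \<or> m = n - 1" "t = replicate n 0 @ replicate m 1" | "t = [0]"
    using t by (auto simp: type3_def)
  then show False
  proof cases
    case 1
    then have "hd (tl t) = 0" by (cases n; cases "n - 1") auto
    then have "reduced t" using t by (simp add: reduced_def)
    moreover have "last t = 1" using 1 by auto
    moreover note N
    moreover have len: "length t = n + m" using 1 by simp
    moreover have "lead 0 t = n" "trail 1 t = m" using 1
      by (auto simp: trail_def)
    ultimately show False using 1(1,2)
    proof (cases rule: reduced_last_one_pred)
      case *: (1 h A)
      have "h = n" using * \<open>lead 0 t = n\<close> lead_tgt_a by metis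
      then show False using len * 1(2) by (auto simp: tgt_a_def)
    next
      case *: (2 k B)
      have "k = m" using * \<open>trail 1 t = m\<close> trail_tgt_b by metis
      then show False using len * 1(1,2) by (auto simp: tgt_b_def)
    qed
  next
    case 2
    have red: "reduced t" using 2 by (simp add: reduced_def)
    have up: "\<exists>k. x = (up ^^ k) [0]" if "dyck_class t = dyck_class x" "is_qdv x" for x
      using dyck_class_eq_reduced[OF that(1) red that(2)] 2 by blast
    have no: False if W: "dyck_class t = dyck_class (0 # 0 # W)" "is_qdv (0 # 0 # W)" for W
    proof -
      obtain k where k: "0 # 0 # W = (up ^^ k) [0]" using up[OF W] by blast
      have "reduced (0 # 0 # W)" using W by (simp add: reduced_def)
      then have "k = 0" by (rule reduced_not_up[OF _ k]) simp
      then show False using k by simp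
    qed
    from N show False
    proof (cases rule: NU_rule_tgtE)
      case (1 U)
      then obtain k where k: "0 # U @ [0] = (up ^^ k) [0]" using up by blast
      then have "last (0 # U @ [0]) = int k" using last_up_funpow[of "[0]" k] by simp
      then have "k = 0" by simp
      then show False using k by simp
    next
      case (2 h A)
      then show False using no tgt_a_Cons is_qdv_tgt_a by metis
    next
      case (3 k B)
      then show False using no tgt_b_Cons is_qdv_tgt_b by metis
    qed
  qed
qed

lemma initial_no_pred: "initial t \<Longrightarrow> \<not> NU_rule c (dyck_class t)"
  using type1_no_pred type2_no_pred type3_no_pred by (auto simp: initial_def is_tdv_iff)

section \<open>Size and deficit\<close>

text \<open>
  \<open>psize\<close> is twice the size of the partition, so that no division by 2 occurs. \<open>deficit\<close> is
  that size minus dinv: the pairs counted by \<open>nondinv\<close> are those not counted by dinv, and \<open>bonus\<close>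
  counts the dinv pairs whose first entry is one of the virtual entries \<open>k - 1\<close> with \<open>k \<le> 0\<close>.
\<close>

definition psize :: "int list \<Rightarrow> int" where
  "psize v = int (length v) * (int (length v) - 1) - 2 * sum_list v"

definition nondinv :: "int \<Rightarrow> int \<Rightarrow> int" where
  "nondinv x y = (if y = x \<or> y = x - 1 then 0 else 1)"

definition bonus :: "int \<Rightarrow> int" where
  "bonus x = (if x \<ge> 0 then 0 else if x = -1 then 1 else 2)"

primrec deficit :: "int list \<Rightarrow> int" where
  "deficit [] = 0"
| "deficit (x # v) = sum_list (map (nondinv x) v) + deficit v - x - bonus x"

lemma sum_list_raise: "sum_list (raise v) = sum_list v + int (length v)"
  by (induction v) auto

lemma psize_up: "psize (up v) = psize v"
  by (simp add: psize_def up_def sum_list_raise algebra_simps)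

text \<open>Letter by letter: raising x changes its own contribution by
  \<open>bonus x - bonus (x + 1) - 1\<close>, and \<open>nondinv 0 (x + 1)\<close> is the exact
  compensation. The virtual entry -1 has become the real leading 0.\<close>

lemma deficit_raise:
  "sum_list (map (nondinv 0) (raise v)) + deficit (raise v) = deficit v"
proof -
  have shift: "map (nondinv (x + 1)) (raise v) = map (nondinv x) v" for x v
    by (induction v) (auto simp: nondinv_def)
  show ?thesis
    by (induction v) (auto simp: shift nondinv_def bonus_def)
qed

lemma deficit_up: "deficit (up v) = deficit v"
  using deficit_raise[of v] by (simp add: up_def bonus_def)

lemma class_invariant:
  assumes "\<And>v. f (up v) = f v" "dyck_class v = dyck_class w" shows "f v = f w"
proof -
  have "f ((up ^^ k) v) = f v" for k v by (induction k) (simp_all add: assms)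
  then show ?thesis using dyck_class_eqE[OF assms(2)] by metis
qed

lemma deficit_append:
  "deficit (v @ w) = deficit v + deficit w + sum_list (map (\<lambda>x. sum_list (map (nondinv x) w)) v)"
  by (induction v) auto

text \<open>Separates the free word \<open>A\<close> from its frame, so that a rule can be checked
  with \<open>A\<close> empty and then for one letter of \<open>A\<close> at a time.\<close>

lemma deficit_insert:
  "deficit (P @ A @ S) = deficit A + deficit (P @ S) +
     sum_list (map (\<lambda>a. sum_list (map (\<lambda>x. nondinv x a) P) + sum_list (map (nondinv a) S)) A)"
proof (induction P)
  case Nil
  show ?case by (simp add: deficit_append)
next
  case (Cons p P)
  then show ?case by (simp add: sum_list_addf)
qed

lemma deficit_replicate: "deficit (replicate n x) = - int n * (x + bonus x)"
  by (induction n) (auto simp: sum_list_replicate nondinv_def algebra_simps)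

lemma sum_list_map_cong:
  "(\<And>x. x \<in> set A \<Longrightarrow> f x = g x) \<Longrightarrow> sum_list (map f A) = sum_list (map g A)"
  by (metis map_cong)

text \<open>The two frames have equal deficit, and any letter at most 2 forms equally many non-dinv
  pairs with either frame. The argument for rule (b) is the same.\<close>

lemma deficit_rule_a:
  assumes "ok_a h A" shows "deficit (src_a h A) = deficit (tgt_a h A)"
proof -
  have h: "int (h - Suc 0) = int h - 1" using assms by (simp add: ok_a_def of_nat_diff)
  have "\<forall>x\<in>set A. x \<le> 2" using assms by (cases "A = []") (auto simp: ok_a_def)
  then have eq: "sum_list (map (\<lambda>x. nondinv x a) ([0, 1] @ replicate h 2)) +
      sum_list (map (nondinv a) (replicate (h - 1) (-1))) =
    sum_list (map (\<lambda>x. nondinv x a) (replicate h 0 @ [1])) + sum_list (map (nondinv a) (replicate h 1))"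
    if a: "a \<in> set A" for a
  proof -
    consider "a = 2" | "a = 1" | "a = 0" | "a = -1" | "a < -1"
      using \<open>\<forall>x\<in>set A. x \<le> 2\<close> a by fastforce
    then show ?thesis by cases (simp_all add: sum_list_replicate h nondinv_def)
  qed
  have "deficit (([0, 1] @ replicate h 2) @ replicate (h - 1) (-1)) =
      deficit ((replicate h 0 @ [1]) @ replicate h 1)"
    by (simp add: deficit_append deficit_replicate sum_list_replicate h nondinv_def bonus_def algebra_simps)
  moreover have "src_a h A = ([0, 1] @ replicate h 2) @ A @ replicate (h - 1) (-1)"
    "tgt_a h A = (replicate h 0 @ [1]) @ A @ replicate h 1"
    by (simp_all add: src_a_def tgt_a_def)
  ultimately show ?thesis
    using sum_list_map_cong[of A, OF eq] by (simp only: deficit_insert)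
qed

lemma deficit_rule_b:
  assumes "ok_b k B" shows "deficit (src_b k B) = deficit (tgt_b k B)"
proof -
  have "\<forall>x\<in>set B. x \<le> 2" using assms by (cases "B = []") (auto simp: ok_b_def)
  then have eq: "sum_list (map (\<lambda>x. nondinv x a) ([0, 1] @ replicate k 2)) +
      sum_list (map (nondinv a) (replicate k (-1))) =
    sum_list (map (\<lambda>x. nondinv x a) (replicate (Suc k) 0)) + sum_list (map (nondinv a) ([0] @ replicate k 1))"
    if a: "a \<in> set B" for a
  proof -
    consider "a = 2" | "a = 1" | "a = 0" | "a = -1" | "a < -1"
      using \<open>\<forall>x\<in>set B. x \<le> 2\<close> a by fastforce
    then show ?thesis by cases (simp_all add: sum_list_replicate nondinv_def)
  qed
  have "deficit (([0, 1] @ replicate k 2) @ replicate k (-1)) =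
      deficit (replicate (Suc k) 0 @ [0] @ replicate k 1)"
    by (simp add: deficit_append deficit_replicate sum_list_replicate nondinv_def bonus_def algebra_simps)
  moreover have "src_b k B = ([0, 1] @ replicate k 2) @ B @ replicate k (-1)"
    "tgt_b k B = replicate (Suc k) 0 @ B @ ([0] @ replicate k 1)"
    by (simp_all add: src_b_def tgt_b_def)
  ultimately show ?thesis
    using sum_list_map_cong[of B, OF eq] by (simp only: deficit_insert)
qed

text \<open>For any x, the pairs (1,x) and (x,0) are both dinv pairs or both not. The non-dinv pair
  formed by the first two letters of the source is offset by the loss of 1 in the letter
  sum.\<close>

lemma deficit_rotate: "deficit (0 # 1 # U) = deficit (0 # U @ [0])"
proof -
  have "sum_list (map (nondinv 1) U) = sum_list (map (\<lambda>x. nondinv x 0) U)"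
    by (rule sum_list_map_cong) (auto simp: nondinv_def)
  moreover have "nondinv 0 1 = 1" "nondinv 0 0 = 0" by (simp_all add: nondinv_def)
  ultimately show ?thesis by (simp add: deficit_append bonus_def)
qed

lemma psize_rules:
  "psize (0 # U @ [0]) = psize (0 # 1 # U) + 2"
  "ok_a h A \<Longrightarrow> psize (tgt_a h A) = psize (src_a h A) + 2"
  "psize (tgt_b k B) = psize (src_b k B) + 2"
  by (auto simp: psize_def tgt_a_def src_a_def tgt_b_def src_b_def ok_a_def sum_list_replicate of_nat_diff)

lemma NU_rule_invariants:
  assumes "NU_rule (dyck_class v) (dyck_class u)"
  shows "psize u = psize v + 2" "deficit u = deficit v"
proof -
  obtain x y where xy: "dyck_class v = dyck_class x" "dyck_class u = dyck_class y"
    "psize y = psize x + 2" "deficit x = deficit y"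
    using assms by cases (metis psize_rules deficit_rotate deficit_rule_a deficit_rule_b)+
  then show "psize u = psize v + 2" "deficit u = deficit v"
    using class_invariant[of psize, OF psize_up] class_invariant[of deficit, OF deficit_up] by metis+
qed

lemma psize_snoc: "psize (v @ [x]) = psize v + 2 * (int (length v) - x)"
  by (simp add: psize_def algebra_simps)

lemma psize_nonneg: "is_qdv v \<Longrightarrow> last v < int (length v) \<and> psize v \<ge> 0"
proof (induction v rule: rev_induct)
  case (snoc x v)
  show ?case
  proof (cases "v = []")
    case True
    then show ?thesis using snoc by (simp add: psize_def)
  next
    case False
    then have "is_qdv v" "x \<le> last v + 1" using snoc by (auto simp: is_qdv_def)
    then show ?thesis using snoc by (auto simp: psize_snoc)
  qed
qed simp

lemma psize_le:
  assumes "\<And>x. x \<in> set v \<Longrightarrow> x \<ge> -1" shows "psize v \<le> int (length v) * (int (length v) + 1)"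
proof -
  have "sum_list v \<ge> - int (length v)" using assms by (induction v) force+
  then show ?thesis by (simp add: psize_def algebra_simps)
qed

section \<open>Lower bounds for the deficit in terms of the length\<close>

lemma deficit_snoc: "deficit (v @ [y]) = deficit v + sum_list (map (\<lambda>x. nondinv x y) v) - y - bonus y"
  by (simp add: deficit_append)

lemma nondinv_counts:
  assumes "set v \<subseteq> {-1..2}"
  shows "sum_list (map (\<lambda>x. nondinv x 0) v) = int (count_list v (-1)) + int (count_list v 2)"
    "sum_list (map (\<lambda>x. nondinv x 1) v) = int (count_list v (-1)) + int (count_list v 0)"
    "sum_list (map (\<lambda>x. nondinv x 2) v) = int (count_list v (-1)) + int (count_list v 0) + int (count_list v 1)"
    "sum_list (map (\<lambda>x. nondinv x (-1)) v) = int (count_list v 1) + int (count_list v 2)"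
    "length v = count_list v (-1) + count_list v 0 + count_list v 1 + count_list v 2"
proof -
  have "x = -1 \<or> x = 0 \<or> x = 1 \<or> x = (2::int)" if "-1 \<le> x" "x \<le> 2" for x using that by auto
  then show "sum_list (map (\<lambda>x. nondinv x 0) v) = int (count_list v (-1)) + int (count_list v 2)"
    "sum_list (map (\<lambda>x. nondinv x 1) v) = int (count_list v (-1)) + int (count_list v 0)"
    "sum_list (map (\<lambda>x. nondinv x 2) v) = int (count_list v (-1)) + int (count_list v 0) + int (count_list v 1)"
    "sum_list (map (\<lambda>x. nondinv x (-1)) v) = int (count_list v 1) + int (count_list v 2)"
    "length v = count_list v (-1) + count_list v 0 + count_list v 1 + count_list v 2"
    using assms by (induction v; fastforce simp: nondinv_def)+
qed

lemma is_qdv_snocD: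
  "is_qdv (v @ [y]) \<Longrightarrow> v \<noteq> [] \<Longrightarrow> is_qdv v \<and> y \<le> last v + 1"
  by (auto simp: is_qdv_def)

lemma is_tdv_snocD:
  "is_tdv (v @ [y]) \<Longrightarrow> v \<noteq> [] \<Longrightarrow> is_tdv v \<and> y \<le> last v + 1 \<and> y \<in> {0, 1, 2}"
  by (auto simp: is_tdv_iff dest: is_qdv_snocD)

lemma count_pos: "x \<in> set v \<Longrightarrow> count_list v x \<ge> 1"
  by (metis One_nat_def Suc_leI count_list_0_iff gr0I)

lemma zero_in_qdv: "is_qdv v \<Longrightarrow> 0 \<in> set v"
  by (cases v) auto

lemma tdv_before_two: "is_tdv (v @ [2]) \<Longrightarrow> 1 \<in> set v"
proof (induction v rule: rev_induct)
  case (snoc x v)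
  have "is_tdv (v @ [x])" "x \<ge> 1" "x \<in> {0, 1, 2}"
    using is_tdv_snocD[OF snoc.prems] by (auto simp: is_tdv_iff)
  then show ?case using snoc.IH by auto
qed (simp add: is_tdv_iff)

lemma tdv_counts:
  assumes "is_tdv v"
  shows "set v \<subseteq> {-1..2}" "count_list v (-1) = 0" "count_list v 0 \<ge> 1"
  using assms zero_in_qdv[of v] count_pos[of 0 v] by (auto simp: is_tdv_iff count_list_0_iff)

lemma tdv_two_counts: "is_tdv (v @ [2]) \<Longrightarrow> count_list v 1 \<ge> 1"
  using tdv_before_two count_pos by metis

text \<open>With c0, c1, c2 the letter counts so far, appending 0, 1 or 2 adds c2, c0 - 1 or c0 + c1
  - 2 to the deficit. None is negative, as c0 >= 1 always and c1 >= 1 before a 2. The bounds are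
  proved together because the first one starts the other two.\<close>

lemma deficit_tdv:
  assumes "is_tdv v"
  shows "deficit v \<ge> 0"
    "count_list v 0 \<ge> 2 \<Longrightarrow> deficit v \<ge> int (count_list v 2)"
    "2 \<in> set v \<Longrightarrow> deficit v \<ge> int (count_list v 0) - 1"
proof -
  have "deficit v \<ge> 0 \<and> (count_list v 0 \<ge> 2 \<longrightarrow> deficit v \<ge> int (count_list v 2)) \<and>
    (2 \<in> set v \<longrightarrow> deficit v \<ge> int (count_list v 0) - 1)"
    using assms
  proof (induction v rule: rev_induct)
    case (snoc y v)
    show ?case
    proof (cases "v = []")
      case True
      then show ?thesis using snoc by (auto simp: is_tdv_iff bonus_def)
    next
      case False
      have v: "is_tdv v" "y = 0 \<or> y = 1 \<or> y = 2" using is_tdv_snocD[OF snoc.prems False] by auto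
      note c = nondinv_counts[OF tdv_counts(1)[OF v(1)]]
      note IH = snoc.IH[OF v(1)]
      have two: "2 \<in> set v \<Longrightarrow> count_list v 2 \<ge> 1" using count_pos by metis
      have two': "2 \<notin> set v \<Longrightarrow> count_list v 2 = 0" by (simp add: count_list_0_iff)
      show ?thesis using v(2)
      proof (elim disjE)
        assume y: "y = 0"
        show ?thesis using IH tdv_counts[OF v(1)] two two' unfolding y
          by (cases "2 \<in> set v"; cases "count_list v 0 \<ge> 2") (simp_all add: deficit_snoc c bonus_def)
      next
        assume y: "y = 1"
        show ?thesis using IH tdv_counts[OF v(1)] unfolding y
          by (auto simp: deficit_snoc c bonus_def)
      next
        assume y: "y = 2"
        show ?thesis using IH tdv_counts[OF v(1)] tdv_two_counts[of v] snoc.prems unfolding y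
          by (auto simp: deficit_snoc c bonus_def)
      qed
    qed
  qed (simp add: is_tdv_iff)
  then show "deficit v \<ge> 0"
    "count_list v 0 \<ge> 2 \<Longrightarrow> deficit v \<ge> int (count_list v 2)"
    "2 \<in> set v \<Longrightarrow> deficit v \<ge> int (count_list v 0) - 1" by auto
qed

text \<open>\<open>P\<close> has deficit at least its number of twos, and the appended 2 adds its
  zeros and ones minus 2; this gives length minus 3 after the 2. From there on two zeros and a 2 are
  present, so every further letter adds at least 1.\<close>

lemma deficit_two_zeros:
  assumes "is_tdv (P @ 2 # Q)" "count_list P 0 \<ge> 2"
  shows "deficit (P @ 2 # Q) \<ge> int (length (P @ 2 # Q)) - 3"
  using assms(1)
proof (induction Q rule: rev_induct)
  case Nil
  have "P \<noteq> []" using assms(2) by auto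
  then have P: "is_tdv P" using is_tdv_snocD[of P 2] Nil by simp
  note c = nondinv_counts[OF tdv_counts(1)[OF P]]
  show ?case using deficit_tdv(2)[OF P assms(2)] tdv_counts[OF P] by (simp add: deficit_snoc c bonus_def)
next
  case (snoc y Q)
  let ?v = "P @ 2 # Q"
  have v: "is_tdv ?v" "y = 0 \<or> y = 1 \<or> y = 2" using is_tdv_snocD[of ?v y] snoc by auto
  note c = nondinv_counts[OF tdv_counts(1)[OF v(1)]]
  have "count_list ?v 0 \<ge> 2" "count_list ?v 2 \<ge> 1" using assms(2) by simp_all
  then have "deficit (?v @ [y]) \<ge> deficit ?v + 1"
    using v(2) tdv_counts[OF v(1)] tdv_two_counts[of ?v] snoc.prems unfolding deficit_snoc[of ?v]
    by (elim disjE) (simp_all only: c bonus_def, simp_all)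
  then show ?case using snoc.IH[OF v(1)] by simp
qed

text \<open>\<open>R\<close> contributes at least its zeros minus 1, and the appended -1 adds its
  ones and twos. Afterwards -1, 0 and 2 have all occurred, so every further letter -1, 0 or 1 adds
  at least 1.\<close>

lemma deficit_two_minus:
  assumes "ctdv (R @ -1 # Q)" "is_tdv R" "2 \<in> set R"
  shows "deficit (R @ -1 # Q) \<ge> int (length (R @ -1 # Q)) - 3"
  using assms(1)
proof (induction Q rule: rev_induct)
  case Nil
  note c = nondinv_counts[OF tdv_counts(1)[OF assms(2)]]
  show ?case using deficit_tdv(3)[OF assms(2,3)] tdv_counts[OF assms(2)] by (simp add: deficit_snoc c bonus_def)
next
  case (snoc y Q)
  let ?v = "R @ -1 # Q"
  have v: "ctdv ?v" using is_qdv_snocD[of ?v y] snoc.prems by (auto simp: ctdv_def)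
  have y: "y = -1 \<or> y = 0 \<or> y = 1" using snoc.prems by (auto simp: ctdv_def)
  have "set ?v \<subseteq> {-1..2}" using v cyc_set unfolding ctdv_def by blast
  note c = nondinv_counts[OF this]
  have "count_list ?v 0 \<ge> 1" "count_list ?v 2 \<ge> 1" "count_list ?v (-1) \<ge> 1"
    using tdv_counts[OF assms(2)] count_pos[OF assms(3)] by simp_all
  then have "deficit (?v @ [y]) \<ge> deficit ?v + 1"
    using y unfolding deficit_snoc[of ?v]
    by (elim disjE) (simp_all only: c bonus_def, simp_all)
  then show ?case using snoc.IH[OF v] by simp
qed

definition cbdv :: "int list \<Rightarrow> bool" where
  "cbdv v \<longleftrightarrow> is_qdv v \<and> cyc 1 v"

text \<open>Lowering turns a forbidden pair -1, 1 of a binary word into a 0 before a 2 in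
  \<open>V\<close>. Together with the initial 0 of a TDV this supplies the two zeros for
  \<open>deficit_two_zeros\<close>.\<close>

lemma cyc_lower_or_zero_two:
  assumes "set V \<subseteq> {0..2}"
  shows "cyc 1 (lower V) \<or> (\<exists>P Q. V = P @ 2 # Q \<and> 0 \<in> set P)"
  using assms
proof (induction V)
  case (Cons x V)
  show ?case
  proof (cases "\<exists>P Q. V = P @ 2 # Q \<and> 0 \<in> set P")
    case True
    then obtain P Q where "V = P @ 2 # Q" "0 \<in> set P" by blast
    then have "x # V = (x # P) @ 2 # Q" "0 \<in> set (x # P)" by auto
    then show ?thesis by blast
  next
    case False
    then have IH: "cyc 1 (lower V)" using Cons by auto
    show ?thesis
    proof (cases "x = 0 \<and> 2 \<in> set V")
      case True
      then obtain P Q where "V = P @ 2 # Q" by (meson split_list)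
      then have "x # V = (x # P) @ 2 # Q" "0 \<in> set (x # P)" using True by auto
      then show ?thesis by blast
    next
      case False
      then show ?thesis using IH Cons.prems by auto
    qed
  qed
qed simp

lemma tdv_cases:
  assumes v: "is_tdv v" "2 \<in> set v"
  shows "(\<exists>w. cbdv w \<and> dyck_class v = dyck_class w) \<or> deficit v \<ge> int (length v) - 3"
proof -
  obtain V where V: "v = 0 # V" using v by (auto simp: is_tdv_iff elim: is_qdvE)
  have "V \<noteq> []" "set V \<subseteq> {0..2}" using v V by (auto simp: is_tdv_iff)
  from cyc_lower_or_zero_two[OF this(2)] show ?thesis
  proof
    assume c: "cyc 1 (lower V)"
    \<comment> \<open>A first letter 0 would be lowered to -1, after which the lowered 2, a 1, could
      not occur.\<close>
    have "hd V = 1"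
    proof (cases V)
      case (Cons y W)
      then show ?thesis using c v V by (cases "y = 0") (auto simp: is_tdv_iff)
    qed (simp add: \<open>V \<noteq> []\<close>)
    then have "is_qdv (lower V)" using v V \<open>V \<noteq> []\<close> by (auto simp: is_tdv_iff is_qdv_def)
    moreover have "v = up (lower V)" by (simp add: V up_def)
    ultimately show ?thesis using c by (auto simp: cbdv_def)
  next
    assume "\<exists>P Q. V = P @ 2 # Q \<and> 0 \<in> set P"
    then obtain P Q where "V = P @ 2 # Q" "0 \<in> set P" by blast
    then have "v = (0 # P) @ 2 # Q" "count_list (0 # P) 0 \<ge> 2" using V count_pos[of 0 P] by auto
    then show ?thesis using deficit_two_zeros[of "0 # P" Q] v by simp
  qed
qed

lemma ctdv_cases:
  assumes v: "ctdv v"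
  shows "(\<exists>w. cbdv w \<and> dyck_class v = dyck_class w) \<or>
    (\<exists>w. ctdv w \<and> dyck_class v = dyck_class w \<and> deficit w \<ge> int (length w) - 3)"
proof -
  have letters: "x = 0 \<or> x = 1 \<or> x = 2" if "x \<in> set v" "x \<noteq> -1" for x
    using cyc_in_set[of 2 v x] v that by (auto simp: ctdv_def)
  consider "2 \<notin> set v" "-1 \<notin> set v" | "2 \<notin> set v" "-1 \<in> set v" | "2 \<in> set v" "-1 \<notin> set v"
    | "2 \<in> set v" "-1 \<in> set v" by blast
  then show ?thesis
  proof cases
    case 1
    then have "set v \<subseteq> {0..1}" using letters by force
    then have "cbdv v" using v by (simp add: cbdv_def ctdv_def cyc_nonneg)
    then show ?thesis by blast
  next
    case 2
    have q: "is_qdv v" using v by (simp add: ctdv_def)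
    have "x + 1 \<in> {0..2}" if "x \<in> set v" for x
      using letters[OF that] 2 that by (cases "x = -1") auto
    \<comment> \<open>No 2 occurs, so one shift removes every -1 and stays ternary; this reduces to
      \<open>tdv_cases\<close>.\<close>
    then have "set (up v) \<subseteq> {0..2}" by (auto simp: up_def)
    then have t: "is_tdv (up v)" using q by (simp add: is_tdv_iff is_qdv_up)
    show ?thesis
    proof (cases "2 \<in> set (up v)")
      case True
      then show ?thesis using tdv_cases[OF t] ctdv_if_tdv[OF t] dyck_class_up[OF q] by metis
    next
      case False
      then have "set v \<subseteq> {-1..<1}" using 2 \<open>set (up v) \<subseteq> {0..2}\<close> letters by (force simp: up_def)
      then have "cbdv v" using q by (simp add: cbdv_def cyc_no_max)
      then show ?thesis by blast
    qed
  next
    case 3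
    then have "is_tdv v" using letters v by (force simp: is_tdv_iff ctdv_def)
    then show ?thesis using tdv_cases 3 v by blast
  next
    case 4
    then obtain R Q where RQ: "v = R @ -1 # Q" "-1 \<notin> set R" by (metis split_list_first)
    then have "R \<noteq> []" using v by (auto simp: ctdv_def)
    then have "is_qdv R" using v RQ by (auto simp: ctdv_def is_qdv_def)
    moreover have "set R \<subseteq> {0..2}" using letters RQ by force
    ultimately have "is_tdv R" by (simp add: is_tdv_iff)
    moreover have "2 \<in> set R" using 4 v RQ by (auto simp: ctdv_def)
    ultimately show ?thesis using deficit_two_minus[of R Q] v RQ by blast
  qed
qed

section \<open>Tails\<close>

lemma binary_blocks:
  assumes "set B \<subseteq> {0, 1}" "B \<noteq> [] \<longrightarrow> hd B = (0::int)"
  shows "\<exists>ns. B = concat (map (\<lambda>n. 0 # replicate n 1) ns)"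
  using assms
proof (induction B rule: rev_induct)
  case (snoc x B)
  then have "B \<noteq> [] \<longrightarrow> hd B = 0" by auto
  then obtain ns where ns: "B = concat (map (\<lambda>n. 0 # replicate n 1) ns)" using snoc by auto
  show ?case
  proof (cases "x = 0")
    case True
    then have "B @ [x] = concat (map (\<lambda>n. 0 # replicate n 1) (ns @ [0]))" using ns by simp
    then show ?thesis by blast
  next
    case False
    then have "B \<noteq> []" "x = 1" using snoc.prems by auto
    then obtain ms n where "ns = ms @ [n]" using ns by (cases ns rule: rev_cases) auto
    then have "B @ [x] = concat (map (\<lambda>n. 0 # replicate n 1) (ms @ [Suc n]))"
      using ns \<open>x = 1\<close> by (simp add: replicate_append_same)
    then show ?thesis by blast
  qed
qed (auto intro: exI[of _ "[]"])

lemma partition_multiplicities: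
  "\<exists>\<mu>. is_partition \<mu> \<and> set \<mu> \<subseteq> {1..length ns} \<and> (\<forall>i<length ns. count_list \<mu> (Suc i) = ns ! i)"
proof (induction ns rule: rev_induct)
  case Nil
  then show ?case by (auto simp: is_partition_def intro: exI[of _ "[]"])
next
  case (snoc n ns)
  then obtain \<mu> where \<mu>: "is_partition \<mu>" "set \<mu> \<subseteq> {1..length ns}"
    "\<forall>i<length ns. count_list \<mu> (Suc i) = ns ! i" by blast
  let ?\<nu> = "replicate n (Suc (length ns)) @ \<mu>"
  have "sorted_wrt (\<ge>) (replicate m (a::nat))" for m a
    by (induction m) auto
  moreover have "x \<le> Suc (length ns)" if "x \<in> set \<mu>" for x
    using \<mu>(2) that by force
  ultimately have "is_partition ?\<nu>"
    using \<mu>(1) by (auto simp: is_partition_def sorted_wrt_append)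
  moreover have "count_list (replicate m (a::nat)) b = (if a = b then m else 0)" for m a b
    by (induction m) auto
  moreover have "count_list \<mu> (Suc (length ns)) = 0" using \<mu>(2) by (auto simp: count_list_0_iff)
  ultimately have "is_partition ?\<nu> \<and> set ?\<nu> \<subseteq> {1..length (ns @ [n])} \<and>
      (\<forall>i<length (ns @ [n]). count_list ?\<nu> (Suc i) = (ns @ [n]) ! i)"
    using \<mu>(2,3) by (auto simp: nth_append less_Suc_eq)
  then show ?case by blast
qed

text \<open>The blocks 0 1^n of \<open>B\<close> prescribe the multiplicities. The final 1 makes the
  last multiplicity positive, so the largest part equals the number of blocks and
  \<open>B_word\<close> has no block too few.\<close>

lemma ex_B_word:
  assumes "set B \<subseteq> {0, 1}" "B \<noteq> []" "hd B = 0" "last B = 1"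
  shows "\<exists>\<mu>. is_partition \<mu> \<and> B_word \<mu> = B"
proof -
  obtain ns where ns: "B = concat (map (\<lambda>n. 0 # replicate n 1) ns)"
    using binary_blocks assms by blast
  obtain \<mu> where \<mu>: "is_partition \<mu>" "set \<mu> \<subseteq> {1..length ns}"
    "\<forall>i<length ns. count_list \<mu> (Suc i) = ns ! i" using partition_multiplicities by blast
  obtain ms n where ms: "ns = ms @ [n]" using ns assms(2) by (cases ns rule: rev_cases) auto
  then have "n > 0" using ns assms(4) by (cases n) auto
  then have "count_list \<mu> (length ns) > 0" using \<mu>(3)[rule_format, of "length ms"] ms by simp
  then have mem: "length ns \<in> set \<mu>" by (metis count_notin less_not_refl)
  obtain m \<mu>' where m: "\<mu> = m # \<mu>'" using mem by (cases \<mu>) auto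
  then have "m \<ge> length ns" using mem \<mu>(1) by (auto simp: is_partition_def)
  then have "part \<mu> 1 = length ns" using m \<mu>(2) by (simp add: part_def)
  then have "B_word \<mu> = concat (map (\<lambda>i. 0 # replicate (count_list \<mu> i) 1) (map Suc [0..<length ns]))"
    by (simp add: B_word_def map_Suc_upt)
  also have "\<dots> = concat (map (\<lambda>n. 0 # replicate n 1) (map ((!) ns) [0..<length ns]))"
    using \<mu>(3) by (auto intro!: arg_cong[where f = concat])
  also have "\<dots> = B" using ns by (simp add: map_nth)
  finally show ?thesis using \<mu>(1) by blast
qed

lemma slow_rise_binary: "set B \<subseteq> {0, 1} \<Longrightarrow> slow_rise B"
proof (induction B)
  case (Cons x B)
  then show ?case by (cases B) auto
qed simp

lemma is_tdv_TI: "is_tdv (0 # B_word \<mu>)"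
proof -
  have "set (B_word \<mu>) \<subseteq> {0, 1}" by (auto simp: B_word_def)
  moreover from this have "B_word \<mu> \<noteq> [] \<longrightarrow> hd (B_word \<mu>) \<le> 1" by (cases "B_word \<mu>") auto
  ultimately show ?thesis using slow_rise_binary by (auto simp: is_tdv_iff)
qed

lemma TI_Nil: "TI [] = dyck_class [0]"
  by (simp add: TI_def B_word_def part_def)

lemma is_partition_Nil: "is_partition []"
  by (simp add: is_partition_def)

text \<open>A final -1 or 0 is undone by a rotation that stays cycled binary. A final 1 excludes any
  -1: a word beginning with 00 is then a \<open>TI\<close>, while 01Z1 comes from 012Z, the shift of
  01Z^-, whose tail has letters -1 and 0 only.\<close>

lemma cbdv_pred:
  assumes v: "cbdv v"
  shows "(\<exists>\<mu>. is_partition \<mu> \<and> dyck_class v = TI \<mu>) \<or>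
    (\<exists>u. cbdv u \<and> NU_rule (dyck_class u) (dyck_class v))"
proof -
  obtain V where V: "v = 0 # V" using v by (auto simp: cbdv_def elim: is_qdvE)
  show ?thesis
  proof (cases V rule: rev_cases)
    case Nil
    then show ?thesis using V TI_Nil is_partition_Nil by metis
  next
    case (snoc U x)
    then have v': "v = 0 # U @ [x]" using V by simp
    have "x = -1 \<or> x = 0 \<or> x = 1" using v v' by (auto simp: cbdv_def)
    then consider "x = -1" | "x = 0" | "x = 1" "U = []" | y Z where "x = 1" "U = y # Z"
      by (cases U) auto
    then show ?thesis
    proof cases
      case 1
      then have "cbdv (0 # 0 # U)" using v v' by (cases "U = []") (auto simp: cbdv_def)
      then show ?thesis using rotate_minus[of U] v v' 1 unfolding cbdv_def by blast
    next
      case 2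
      then have "cbdv (0 # 1 # U)" using v v' by (cases "U = []") (auto simp: cbdv_def)
      then show ?thesis using NU_rule.rotate[of U] v v' 2 unfolding cbdv_def by blast
    next
      case 3
      then have "dyck_class v = TI []" using v' dyck_class_up[of "[0]"] by (simp add: TI_Nil)
      then show ?thesis using is_partition_Nil by blast
    next
      case (4 y Z)
      have nonneg: "-1 \<notin> set (0 # U)" using v v' 4(1) by (auto simp: cbdv_def)
      have binary: "set (0 # U @ [x]) \<subseteq> {0, 1}"
      proof -
        have "z = 0 \<or> z = 1" if "z \<in> set v" for z
          using cyc_in_set[of 1 v z] v v' 4(1) nonneg that by (cases "z = -1") (auto simp: cbdv_def)
        then show ?thesis using v' by auto
      qed
      show ?thesis
      proof (cases "y = 0")
        case True
        then have "\<exists>\<mu>. is_partition \<mu> \<and> B_word \<mu> = U @ [x]"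
          using binary 4 by (intro ex_B_word) auto
        then show ?thesis using v' unfolding TI_def by metis
      next
        case False
        then have y: "y = 1" using binary 4 by auto
        then have v1: "v = 0 # 1 # Z @ [1]" "is_qdv (0 # 1 # lower Z)"
          using v v' 4 by (auto simp: cbdv_def hd_append split: if_splits)
        have "set (lower Z) \<subseteq> {-1..<1}" using binary 4 by auto
        then have "cbdv (0 # 1 # lower Z)" using v1(2) by (simp add: cbdv_def cyc_no_max)
        moreover have "NU_rule (dyck_class (0 # 1 # lower Z)) (dyck_class v)"
          using rotate_one[of Z] dyck_class_up[OF v1(2)] v v1(1) by (simp add: cbdv_def)
        ultimately show ?thesis by blast
      qed
    qed
  qed
qed

section \<open>Orbits of cycled ternary classes under \<open>NU\<close>\<close>

definition ct_class :: "int list set \<Rightarrow> bool" where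
  "ct_class c \<longleftrightarrow> (\<exists>v. ctdv v \<and> c = dyck_class v)"

lemma ct_class_NU:
  assumes "ct_class c" shows "ct_class (NU c)" "NU_rule c (NU c)"
proof -
  obtain v where v: "ctdv v" "c = dyck_class v" using assms by (auto simp: ct_class_def)
  then obtain u where "ctdv u" "NU_rule c (dyck_class u)" using ctdv_succ by blast
  then show "ct_class (NU c)" "NU_rule c (NU c)" using NU_eq by (auto simp: ct_class_def)
qed

lemma ct_class_NU_funpow: "ct_class c \<Longrightarrow> ct_class ((NU ^^ k) c)"
  by (induction k) (simp_all add: ct_class_NU)

lemma reach_initial:
  assumes "ctdv v" shows "\<exists>t k. initial t \<and> dyck_class v = (NU ^^ k) (dyck_class t)"
  using assms
proof (induction "nat (psize v)" arbitrary: v rule: less_induct)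
  case less
  from has_pred_ctdv[OF less.prems] consider
    u where "ctdv u" "NU_rule (dyck_class u) (dyck_class v)" | t where "initial t" "dyck_class v = dyck_class t"
    by (auto simp: has_pred_def)
  then show ?case
  proof cases
    case 1
    have "psize u \<ge> 0" using 1 psize_nonneg by (auto simp: ctdv_def)
    then have "nat (psize u) < nat (psize v)" using NU_rule_invariants(1)[OF 1(2)] by simp
    then obtain t k where "initial t" "dyck_class u = (NU ^^ k) (dyck_class t)"
      using less.hyps 1(1) by blast
    then have "dyck_class v = (NU ^^ Suc k) (dyck_class t)" using NU_eq[OF 1(2)] by simp
    then show ?thesis using \<open>initial t\<close> by blast
  next
    case 2
    then have "dyck_class v = (NU ^^ 0) (dyck_class t)" by simp
    then show ?thesis using 2 by blast
  qed
qed

lemma reach_TI: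
  assumes "cbdv v" shows "\<exists>\<mu> k. is_partition \<mu> \<and> dyck_class v = (NU ^^ k) (TI \<mu>)"
  using assms
proof (induction "nat (psize v)" arbitrary: v rule: less_induct)
  case less
  from cbdv_pred[OF less.prems] consider
    u where "cbdv u" "NU_rule (dyck_class u) (dyck_class v)" | \<mu> where "is_partition \<mu>" "dyck_class v = TI \<mu>"
    by blast
  then show ?case
  proof cases
    case 1
    have "psize u \<ge> 0" using 1 psize_nonneg by (auto simp: cbdv_def)
    then have "nat (psize u) < nat (psize v)" using NU_rule_invariants(1)[OF 1(2)] by simp
    then obtain \<mu> k where "is_partition \<mu>" "dyck_class u = (NU ^^ k) (TI \<mu>)"
      using less.hyps 1(1) by blast
    then have "dyck_class v = (NU ^^ Suc k) (TI \<mu>)" using NU_eq[OF 1(2)] by simp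
    then show ?thesis using \<open>is_partition \<mu>\<close> by blast
  next
    case 2
    then have "dyck_class v = (NU ^^ 0) (TI \<mu>)" by simp
    then show ?thesis using 2 by blast
  qed
qed

lemma orbit_invariants:
  assumes "ctdv t"
  shows "\<exists>v. ctdv v \<and> (NU ^^ k) (dyck_class t) = dyck_class v \<and>
    psize v = psize t + 2 * int k \<and> deficit v = deficit t"
proof (induction k)
  case (Suc k)
  then obtain v where v: "ctdv v" "(NU ^^ k) (dyck_class t) = dyck_class v"
    "psize v = psize t + 2 * int k" "deficit v = deficit t" by blast
  obtain u where u: "ctdv u" "NU_rule (dyck_class v) (dyck_class u)" using ctdv_succ v by blast
  have "(NU ^^ Suc k) (dyck_class t) = dyck_class u" using v(2) NU_eq[OF u(2)] by simp
  then show ?case using u v NU_rule_invariants[OF u(2)] by auto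
qed (use assms in auto)

text \<open>
  Along an orbit the size grows while the deficit is constant. As long as no cycled binary vector
  is reached, the deficit bounds the length of a representative, and hence the size.
\<close>

lemma reach_cbdv:
  assumes "ctdv t" shows "\<exists>k w. cbdv w \<and> (NU ^^ k) (dyck_class t) = dyck_class w"
proof (rule ccontr)
  assume none: "\<not> ?thesis"
  \<comment> \<open>A non-binary representative has length at most \<open>L\<close>, hence
    \<open>psize\<close> at most \<open>L * (L + 1)\<close> by \<open>psize_le\<close>;
    \<open>k\<close> steps exceed this.\<close>
  define L where "L = deficit t + 3"
  define k where "k = nat (L * (L + 1) + 1)"
  obtain v where v: "ctdv v" "(NU ^^ k) (dyck_class t) = dyck_class v"
    "psize v = psize t + 2 * int k" "deficit v = deficit t" using orbit_invariants[OF assms] by blast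
  then obtain w where w: "ctdv w" "dyck_class v = dyck_class w" "deficit w \<ge> int (length w) - 3"
    using ctdv_cases[OF v(1)] none by metis
  have "psize w = psize v" "deficit w = deficit v"
    using w(2) class_invariant[of psize, OF psize_up] class_invariant[of deficit, OF deficit_up] by metis+
  then have len: "int (length w) \<le> L" using w(3) v(4) by (simp add: L_def)
  have "psize w \<le> int (length w) * (int (length w) + 1)"
    using w(1) cyc_in_set[of 2 w] by (intro psize_le) (auto simp: ctdv_def)
  also have "\<dots> \<le> L * (L + 1)" using len by (intro mult_mono) auto
  also have "\<dots> < int k" by (simp add: k_def)
  also have "\<dots> \<le> psize v"
    using v(3) psize_nonneg[of t] assms by (simp add: ctdv_def)
  finally show False using \<open>psize w = psize v\<close> by simp
qed

text \<open>Injectivity removes one \<open>NU\<close> from both sides at a time. The left side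
  cannot run out first, for then \<open>x\<close> would have a predecessor.\<close>

lemma NU_funpow_cancel:
  assumes "ct_class x" "\<And>c. \<not> NU_rule c x"
  shows "ct_class y \<Longrightarrow> (NU ^^ k) x = (NU ^^ j) y \<Longrightarrow> \<exists>m. y = (NU ^^ m) x"
proof (induction j arbitrary: k)
  case 0
  then have "y = (NU ^^ k) x" by simp
  then show ?case by blast
next
  case (Suc j)
  have y: "NU_rule ((NU ^^ j) y) ((NU ^^ Suc j) y)"
    using ct_class_NU(2)[OF ct_class_NU_funpow[OF Suc.prems(1)]] by simp
  show ?case
  proof (cases k)
    case 0
    then show ?thesis using y Suc.prems(2) assms(2) by simp
  next
    case (Suc i)
    have "NU_rule ((NU ^^ i) x) ((NU ^^ Suc i) x)"
      using ct_class_NU(2)[OF ct_class_NU_funpow[OF assms(1)]] by simp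
    then have "(NU ^^ i) x = (NU ^^ j) y"
      using NU_rule_injective y Suc Suc.prems(2) by metis
    then show ?thesis using Suc.IH Suc.prems(1) by blast
  qed
qed

lemma ct_class_initial: "initial t \<Longrightarrow> ct_class (dyck_class t)"
  by (auto simp: initial_def ct_class_def intro: ctdv_if_tdv)

lemma ct_class_TI: "ct_class (TI \<mu>)"
  unfolding ct_class_def TI_def using ctdv_if_tdv[OF is_tdv_TI] by blast

lemma initial_reaches_TI:
  assumes "initial t" shows "\<exists>\<mu> m. is_partition \<mu> \<and> TI \<mu> = (NU ^^ m) (dyck_class t)"
proof -
  have "ctdv t" using assms by (simp add: initial_def ctdv_if_tdv)
  then obtain k w where w: "cbdv w" "(NU ^^ k) (dyck_class t) = dyck_class w" using reach_cbdv by blast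
  obtain \<mu> j where \<mu>: "is_partition \<mu>" "dyck_class w = (NU ^^ j) (TI \<mu>)" using reach_TI[OF w(1)] by blast
  then have "\<exists>m. TI \<mu> = (NU ^^ m) (dyck_class t)"
    using NU_funpow_cancel[OF ct_class_initial[OF assms] initial_no_pred[OF assms] ct_class_TI, of k j] w(2)
    by simp
  then show ?thesis using \<mu>(1) by blast
qed

text \<open>\<open>ND\<close> retraces the orbit of \<open>t\<close>. Every class met before step m
  has a predecessor and the class of \<open>t\<close> has none, so the \<open>LEAST\<close> is
  exactly m.\<close>

lemma TI2_eq:
  assumes t: "initial t" and m: "TI \<mu> = (NU ^^ m) (dyck_class t)"
  shows "TI2 \<mu> = dyck_class t"
proof -
  let ?T = "dyck_class t"
  have step: "NU_rule ((NU ^^ i) ?T) ((NU ^^ Suc i) ?T)" for i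
    using ct_class_NU(2)[OF ct_class_NU_funpow[OF ct_class_initial[OF t]]] by simp
  have ND: "(ND ^^ j) (TI \<mu>) = (NU ^^ (m - j)) ?T" if "j \<le> m" for j
    using that
  proof (induction j)
    case (Suc j)
    then have "m - j = Suc (m - Suc j)" by simp
    then show ?case using Suc ND_eq[OF step[of "m - Suc j"]] by simp
  qed (simp add: m)
  have "(LEAST k. (ND ^^ k) (TI \<mu>) \<notin> ND_dom) = m"
  proof (rule Least_equality)
    show "(ND ^^ m) (TI \<mu>) \<notin> ND_dom"
      using initial_no_pred[OF t] by (simp add: ND ND_dom_iff)
    fix j assume j: "(ND ^^ j) (TI \<mu>) \<notin> ND_dom"
    show "m \<le> j"
    proof (rule ccontr)
      assume "\<not> m \<le> j"
      then have "m - j = Suc (m - Suc j)" "j \<le> m" by simp_all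
      then have "(ND ^^ j) (TI \<mu>) \<in> ND_dom" using step[of "m - Suc j"] ND by (auto simp: ND_dom_iff)
      then show False using j by blast
    qed
  qed
  then show ?thesis by (simp add: TI2_def ND)
qed

lemma TI2_initial: "\<exists>t. initial t \<and> TI2 \<mu> = dyck_class t"
proof -
  obtain t k where "initial t" "TI \<mu> = (NU ^^ k) (dyck_class t)"
    using reach_initial[OF ctdv_if_tdv[OF is_tdv_TI]] unfolding TI_def by blast
  then show ?thesis using TI2_eq by blast
qed

lemma initial_TI2: "initial t \<Longrightarrow> \<exists>\<mu>. is_partition \<mu> \<and> TI2 \<mu> = dyck_class t"
  using initial_reaches_TI TI2_eq by blast

text \<open>\<open>NU\<close> never leaves its domain here, because every cycled ternary class has a
  cycled ternary successor; the tails are infinite orbits.\<close>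

lemma TAIL2_eq: "TAIL2 \<mu> = {(NU ^^ m) (TI2 \<mu>) | m. True}"
proof -
  have "ct_class (TI2 \<mu>)" using TI2_initial[of \<mu>] ct_class_initial by auto
  then have "(NU ^^ i) (TI2 \<mu>) \<in> NU_dom" for i
    using ct_class_NU(2) ct_class_NU_funpow NU_dom_iff by blast
  then show ?thesis by (simp add: TAIL2_def)
qed

lemma TAIL2_iff: "(\<exists>\<mu>. is_partition \<mu> \<and> c \<in> TAIL2 \<mu>) \<longleftrightarrow> ct_class c"
proof
  assume "\<exists>\<mu>. is_partition \<mu> \<and> c \<in> TAIL2 \<mu>"
  then obtain \<mu> m where "c = (NU ^^ m) (TI2 \<mu>)" by (auto simp: TAIL2_eq)
  moreover obtain t where "initial t" "TI2 \<mu> = dyck_class t" using TI2_initial by blast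
  ultimately show "ct_class c" by (simp add: ct_class_NU_funpow ct_class_initial)
next
  assume "ct_class c"
  then obtain v where "ctdv v" "c = dyck_class v" by (auto simp: ct_class_def)
  then obtain t k where t: "initial t" "c = (NU ^^ k) (dyck_class t)" using reach_initial by blast
  obtain \<mu> where "is_partition \<mu>" "TI2 \<mu> = dyck_class t" using initial_TI2[OF t(1)] by blast
  moreover have "c \<in> TAIL2 \<mu>" using t \<open>TI2 \<mu> = dyck_class t\<close> by (auto simp: TAIL2_eq)
  ultimately show "\<exists>\<mu>. is_partition \<mu> \<and> c \<in> TAIL2 \<mu>" by blast
qed

theorem theorem3p10:
  fixes w :: "int list"
  assumes "is_qdv w"
  shows "((\<exists>\<mu>. is_partition \<mu> \<and> dyck_class w \<in> TAIL2 \<mu>) \<longleftrightarrow>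
            (\<exists>v. is_cycled_tdv v \<and> dyck_class w = dyck_class v)) \<and>
         ((\<exists>\<mu>. is_partition \<mu> \<and> dyck_class w = TI2 \<mu>) \<longleftrightarrow>
            (\<exists>v. is_tdv v \<and> dyck_class w = dyck_class v \<and> (type1 v \<or> type2 v \<or> type3 v)))"
proof
  show "(\<exists>\<mu>. is_partition \<mu> \<and> dyck_class w \<in> TAIL2 \<mu>) \<longleftrightarrow>
      (\<exists>v. is_cycled_tdv v \<and> dyck_class w = dyck_class v)"
    by (simp add: TAIL2_iff ct_class_def is_cycled_tdv_iff)
  have "(\<exists>\<mu>. is_partition \<mu> \<and> dyck_class w = TI2 \<mu>) \<longleftrightarrow> (\<exists>v. initial v \<and> dyck_class w = dyck_class v)"
    using TI2_initial initial_TI2 by metis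
  then show "(\<exists>\<mu>. is_partition \<mu> \<and> dyck_class w = TI2 \<mu>) \<longleftrightarrow>
      (\<exists>v. is_tdv v \<and> dyck_class w = dyck_class v \<and> (type1 v \<or> type2 v \<or> type3 v))"
    unfolding initial_def by blast
qed

end
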